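(* Let $u\in L^2(0,T;L^2_\rho(\Gamma;V))$ with $\dot u\in L^2(0,T;L^2_\rho(\Gamma;V))$ be the continuous DLR solution (as defined in the context). Then: 1. $$\|u(T)\|_{H,\rho}^2+C_{\mathcal L}\int_0^T\|u(t)\|_{V,\rho}^2\,dt\le\|u(0)\|_{H,\rho}^2+\frac{C_P^2}{C_{\mathcal L}}\|f\|^2_{L^2(0,T;L^2_\rho(\Gamma;H))};$$ 2. if in addition $\mathcal L$ is symmetric, $$\|u(T)\|_{\mathcal L,\rho}^2+\int_0^T\|\dot u(t)\|_{H,\rho}^2\,dt\le\|u(0)\|_{\mathcal L,\rho}^2+\|f\|^2_{L^2(0,T;L^2_\rho(\Gamma;H))}.$$ If moreover $f=0$, then for all $t_1,t_2\in[0,T]$ with $t_1\le t_2$: 3. $\|u(t_2)\|_{H,\rho}\le\|u(t_1)\|_{H,\rho}$; 4. if in addition $\mathcal L$ is symmetric, $\|u(t_2)\|_{\mathcal L,\rho}\le\|u(t_1)\|_{\mathcal L,\rho}$.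
   Context: Setting. $V,H$ are separable real Hilbert spaces forming a Gelfand triple $V\subset H\subset V'$, with $V$ dense in $H$ and $\|v\|_H\le C_P\|v\|_V$ for $v\in V$, $C_P>0$; $(\cdot,\cdot)_{V'V}$ is the duality pairing, extending $\langle\cdot,\cdot\rangle_H$. $(\Gamma,\mathcal F,\rho)$ is a probability space, $L^2_\rho=L^2_\rho(\Gamma)$, $\mathbb E[v]=\int_\Gamma v\,d\rho$ (Bochner integral for vector-valued $v$), $v^*:=v-\mathbb E[v]$. $L^2_\rho(\Gamma;X)$, $X\in\{V,H,V'\}$, are Bochner spaces; for $X\in\{V,H\}$ the norm is $\|v\|_{X,\rho}=(\int_\Gamma\|v\|_X^2d\rho)^{1/2}$. $L:\Gamma\to\mathfrak L(V,V')$ (bounded linear operators) is Borel measurable with constants $C_{\mathcal L},C_{\mathcal B}>0$ such that $(L(\omega)v,v)_{V'V}\ge C_{\mathcal L}\|v\|_V^2$ and $(L(\omega)v,w)_{V'V}\le C_{\mathcal B}\|v\|_V\|w\|_V$ for all $\omega\in\Gamma$, $v,w\in V$. Put $\mathcal L(u)(\omega)=L(\omega)u(\omega)$, $\mathcal L:L^2_\rho(\Gamma;V)\to L^2_\rho(\Gamma;V')$, $\langle v,w\rangle_{\mathcal L,\rho}=\int_\Gamma(\mathcal L(v)(\omega),w(\omega))_{V'V}\,d\rho(\omega)$. "$\mathcal L$ symmetric" means this form is symmetric; then $\|v\|_{\mathcal L,\rho}^2=\langle v,v\rangle_{\mathcal L,\rho}$. The forcing term is $f\in L^2(0,T;L^2_\rho(\Gamma;H))$.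 DLR solution of $\dot u+\mathcal L(u)=f$. Fix $R\in\mathbb N$. The DLR solution is $u(t)=\bar u(t)+\sum_{i=1}^RU_i(t)Y_i(t)\in L^2_\rho(\Gamma;V)$, where $\bar u(t)\in V$, $U_1(t),\dots,U_R(t)\in V$ are linearly independent, $Y_i(t)\in L^2_\rho$ satisfy $\langle Y_i(t),Y_j(t)\rangle_{L^2_\rho}=\delta_{ij}$ and $\mathbb E[Y_j(t)]=0$ for all $t$, and the gauge condition $\langle\dot Y_i(t),Y_j(t)\rangle_{L^2_\rho}=0$ for all $i,j$, and these functions solve, for $j=1,\dots,R$, $$(\dot{\bar u},v)_{V'V}+(\mathbb E[\mathcal L(u)],v)_{V'V}=\langle\mathbb E[f],v\rangle_H\quad\forall v\in V,$$ $$(\dot U_j,v)_{V'V}+(\mathbb E[\mathcal L(u)Y_j],v)_{V'V}=\langle\mathbb E[fY_j],v\rangle_H\quad\forall v\in V,$$ $$\dot Y_j+\sum_{i=1}^R(M^{-1})_{j,i}\,\mathcal P_{\mathcal Y}^\perp\big[(\mathcal L(u)^*,U_i)_{V'V}-\langle f^*,U_i\rangle_H\big]=0\quad\text{in }L^2_\rho,$$ with initial conditions $\bar u(0)\in V$, $Y_j(0)$ orthonormal with zero mean, $U_j(0)\in V$ linearly independent. Here $M_{ij}=\langle U_i,U_j\rangle_H$ and $\mathcal P^\perp_{\mathcal Y}[v]=v-\sum_{j=1}^R\langle v,Y_j\rangle_{L^2_\rho}Y_j$. Existence of the DLR solution is assumed. *)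

theory Defs
  imports "HOL-Probability.Probability"
begin

text \<open>
  Bochner integration in the library is only available in types of class
  \<open>second_countable_topology\<close>. We prove that the dual of a separable inner product space is
  separable, so that integrals with values in \<open>V' = 'v \<Rightarrow>\<^sub>L real\<close> are the library's.
\<close>

lemma countable_dense_imp_countable_subbasis:
  fixes D :: "'a::metric_space set"
  assumes "countable D" and dense: "\<And>x e. e > 0 \<Longrightarrow> \<exists>d\<in>D. dist x d < e"
  shows "\<exists>B::'a set set. countable B \<and> open = generate_topology B"
proof -
  define B where "B = (\<lambda>(d, n). ball d (1 / real (Suc n))) ` (D \<times> (UNIV :: nat set))"
  have "topological_basis B"
  proof (rule topological_basisI)
    fix B' assume "B' \<in> B" then show "open B'" by (auto simp: B_def)
  next
    fix U :: "'a set" and x assume "open U" "x \<in> U"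
    then obtain e where e: "e > 0" "ball x e \<subseteq> U" by (meson openE)
    obtain n where n: "1 / real (Suc n) < e / 2"
      using e(1) nat_approx_posE[of "e / 2"] by auto
    obtain d where d: "d \<in> D" "dist x d < 1 / real (Suc n)"
      using dense[of "1 / real (Suc n)" x] by auto
    have "ball d (1 / real (Suc n)) \<subseteq> ball x e"
    proof
      fix y assume "y \<in> ball d (1 / real (Suc n))"
      then have "dist d y < 1 / real (Suc n)" by simp
      then have "dist x y < e"
        using dist_triangle[of x y d] d(2) n by linarith
      then show "y \<in> ball x e" by simp
    qed
    moreover have "x \<in> ball d (1 / real (Suc n))"
      using d(2) by (simp add: dist_commute)
    moreover have "ball d (1 / real (Suc n)) \<in> B"
      using d(1) by (force simp: B_def)
    ultimately show "\<exists>B'\<in>B. x \<in> B' \<and> B' \<subseteq> U" using e(2) by blast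
  qed
  then have "open = generate_topology B" by (rule topological_basis_imp_subbasis)
  moreover have "countable B" using assms(1) by (simp add: B_def)
  ultimately show ?thesis by blast
qed

lemma real_dual_approx_unit:
  fixes f :: "'v::real_inner \<Rightarrow>\<^sub>L real"
  assumes f1: "norm f = 1" and "e > 0"
  shows "\<exists>x. norm (f - blinfun_inner_right x) \<le> e"
proof -
  define d where "d = min (e / 2) (min 1 (e\<^sup>2 / 8))"
  have d: "0 < d" "d \<le> e / 2" "d \<le> 1" "d \<le> e\<^sup>2 / 8"
    using \<open>e > 0\<close> by (auto simp: d_def)
  have "\<exists>x. \<not> norm (blinfun_apply f x) \<le> (1 - d) * norm x"
  proof (rule ccontr)
    assume "\<nexists>x. \<not> norm (blinfun_apply f x) \<le> (1 - d) * norm x"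
    then have "norm f \<le> 1 - d" using d by (intro norm_blinfun_bound) auto
    then show False using f1 d(1) by simp
  qed
  then obtain x0 where x0: "\<bar>blinfun_apply f x0\<bar> > (1 - d) * norm x0" by (auto simp: not_le)
  then have x0n: "x0 \<noteq> 0" by auto
  define x where "x = (sgn (blinfun_apply f x0) / norm x0) *\<^sub>R x0"
  have fx0: "blinfun_apply f x0 \<noteq> 0"
    using x0 d(3) by (smt (verit) mult_nonneg_nonneg norm_ge_zero)
  have xn: "norm x = 1" using x0n fx0 by (simp add: x_def abs_sgn_eq)
  have fx_eq: "blinfun_apply f x = \<bar>blinfun_apply f x0\<bar> / norm x0"
    by (simp add: x_def blinfun.scaleR_right abs_sgn mult.commute)
  have fx: "blinfun_apply f x > 1 - d"
    using x0 x0n by (simp add: fx_eq field_simps)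
  have fxle: "blinfun_apply f x \<le> 1"
    using norm_blinfun[of f x] f1 xn by simp
  have xx: "inner x x = 1" using xn by (simp add: dot_square_norm)
  have perp: "\<bar>blinfun_apply f z\<bar> \<le> e / 2 * norm z" if z: "inner x z = 0" for z
  proof -
    let ?a = "blinfun_apply f x" and ?b = "blinfun_apply f z"
    define w where "w = (?a * (norm z)\<^sup>2) *\<^sub>R x + ?b *\<^sub>R z"
    have "blinfun_apply f w = ?a\<^sup>2 * (norm z)\<^sup>2 + ?b\<^sup>2"
      by (simp add: w_def blinfun.add_right blinfun.scaleR_right power2_eq_square)
    moreover have "(norm w)\<^sup>2 = ?a\<^sup>2 * (norm z)^4 + ?b\<^sup>2 * (norm z)\<^sup>2"
    proof -
      have "inner w w = (?a * (norm z)\<^sup>2)\<^sup>2 + ?b\<^sup>2 * inner z z"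
        using z xx
        by (simp add: w_def inner_add_left inner_add_right inner_commute[of z x] power2_eq_square)
      then show ?thesis by (simp add: power2_norm_eq_inner power_mult_distrib)
        (simp add: power2_norm_eq_inner[symmetric] flip: power_mult)
    qed
    moreover have "\<bar>blinfun_apply f w\<bar> \<le> norm w" using norm_blinfun[of f w] f1 by simp
    then have "(blinfun_apply f w)\<^sup>2 \<le> (norm w)\<^sup>2"
      by (metis abs_ge_zero power2_abs power_mono)
    ultimately have "(?a\<^sup>2 * (norm z)\<^sup>2 + ?b\<^sup>2)\<^sup>2 \<le> (norm z)\<^sup>2 * (?a\<^sup>2 * (norm z)\<^sup>2 + ?b\<^sup>2)"
      by (simp add: algebra_simps power2_eq_square numeral_eq_Suc)
    then have s: "?a\<^sup>2 * (norm z)\<^sup>2 + ?b\<^sup>2 \<le> (norm z)\<^sup>2"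
      by (smt (verit, best) mult_le_cancel_right power2_eq_square zero_le_power2)
    have "1 - 2 * d \<le> (1 - d)\<^sup>2" by (simp add: power2_eq_square algebra_simps)
    also have "\<dots> \<le> ?a\<^sup>2" using fx d(3) by (intro power_mono) auto
    finally have "(1 - 2 * d) * (norm z)\<^sup>2 \<le> ?a\<^sup>2 * (norm z)\<^sup>2"
      by (rule mult_right_mono) simp
    then have "?b\<^sup>2 \<le> 2 * d * (norm z)\<^sup>2" using s by (simp add: algebra_simps)
    also have "\<dots> \<le> (e\<^sup>2 / 4) * (norm z)\<^sup>2" using d(4) by (intro mult_right_mono) auto
    also have "\<dots> = (e / 2 * norm z)\<^sup>2" by (simp add: power_mult_distrib power_divide)
    finally show ?thesis using \<open>e > 0\<close> by (simp add: abs_le_square_iff[symmetric])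
  qed
  have "norm (f - blinfun_inner_right x) \<le> e"
  proof (rule norm_blinfun_bound)
    fix y
    define a where "a = inner x y"
    define z where "z = y - a *\<^sub>R x"
    have xz: "inner x z = 0" by (simp add: z_def a_def inner_diff_right xx)
    have y: "y = a *\<^sub>R x + z" by (simp add: z_def)
    have "(norm y)\<^sup>2 = a\<^sup>2 + (norm z)\<^sup>2"
      unfolding power2_norm_eq_inner using xz xx
      by (simp add: y inner_add_left inner_add_right inner_commute[of z x] power2_eq_square)
    then have "a\<^sup>2 \<le> (norm y)\<^sup>2" "(norm z)\<^sup>2 \<le> (norm y)\<^sup>2" by simp_all
    then have "\<bar>a\<bar> \<le> norm y" "norm z \<le> norm y"
      by (simp_all add: abs_le_square_iff[symmetric])
    have "blinfun_apply (f - blinfun_inner_right x) y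
        = a * (blinfun_apply f x - 1) + blinfun_apply f z"
      using xz xx
      by (simp add: y blinfun.diff_left blinfun.add_right blinfun.scaleR_right inner_add_right
          algebra_simps)
    also have "\<bar>\<dots>\<bar> \<le> \<bar>a\<bar> * d + e / 2 * norm z"
    proof -
      have "\<bar>a * (blinfun_apply f x - 1)\<bar> \<le> \<bar>a\<bar> * d"
        using fx fxle by (auto simp: abs_mult intro!: mult_left_mono)
      then show ?thesis using perp[OF xz] by linarith
    qed
    also have "\<dots> \<le> norm y * (e / 2) + e / 2 * norm y"
      using \<open>\<bar>a\<bar> \<le> norm y\<close> \<open>norm z \<le> norm y\<close> d \<open>e > 0\<close>
      by (intro add_mono mult_mono) auto
    finally show "norm (blinfun_apply (f - blinfun_inner_right x) y) \<le> e * norm y"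
      by (simp add: algebra_simps)
  qed (use \<open>e > 0\<close> in simp)
  then show ?thesis by blast
qed

lemma real_dual_approx:
  fixes f :: "'v::real_inner \<Rightarrow>\<^sub>L real"
  assumes "e > 0"
  shows "\<exists>x. norm (f - blinfun_inner_right x) < e"
proof (cases "f = 0")
  case True
  have "blinfun_inner_right (0::'v) = 0" by (rule blinfun_eqI) simp
  then show ?thesis using True assms by (intro exI[of _ 0]) simp
next
  case False
  then have "norm ((1 / norm f) *\<^sub>R f) = 1" by simp
  from real_dual_approx_unit[OF this, of "e / (2 * norm f)"] False assms
  obtain x where x: "norm ((1 / norm f) *\<^sub>R f - blinfun_inner_right x) \<le> e / (2 * norm f)"
    by auto
  have "f - blinfun_inner_right (norm f *\<^sub>R x)
      = norm f *\<^sub>R ((1 / norm f) *\<^sub>R f - blinfun_inner_right x)"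
    using False by (intro blinfun_eqI) (simp add: blinfun.diff_left blinfun.scaleR_left algebra_simps)
  then have "norm (f - blinfun_inner_right (norm f *\<^sub>R x))
      = norm f * norm ((1 / norm f) *\<^sub>R f - blinfun_inner_right x)" by simp
  also have "\<dots> \<le> norm f * (e / (2 * norm f))" using x by (intro mult_left_mono) auto
  also have "\<dots> < e" using False assms by simp
  finally show ?thesis by blast
qed

instance blinfun :: ("{real_inner, second_countable_topology}", euclidean_space)
  second_countable_topology
proof
  obtain D :: "'a set" where D: "countable D" "\<And>X. open X \<Longrightarrow> X \<noteq> {} \<Longrightarrow> \<exists>d\<in>D. d \<in> X"
    by (rule countable_dense_setE) blast
  define J :: "('b \<Rightarrow> 'a) \<Rightarrow> 'a \<Rightarrow>\<^sub>L 'b" where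
    "J = (\<lambda>d. \<Sum>b\<in>Basis. blinfun_scaleR_left b o\<^sub>L (blinfun_inner_right (d b)))"
  have "countable (J ` (Pi\<^sub>E Basis (\<lambda>_. D)))"
    by (intro countable_image countable_PiE) (auto simp: D)
  moreover have "\<exists>g\<in>J ` (Pi\<^sub>E Basis (\<lambda>_. D)). dist f g < e" if "e > 0" for f and e :: real
  proof -
    define n where "n = real (card (Basis :: 'b set))"
    have n: "n > 0" by (simp add: n_def)
    have "\<exists>d\<in>D. norm ((blinfun_inner_right b o\<^sub>L f) - blinfun_inner_right d) < e / n" for b
    proof -
      obtain x where x: "norm ((blinfun_inner_right b o\<^sub>L f) - blinfun_inner_right x) < e / n / 2"
        using real_dual_approx[of "e / n / 2"] \<open>e > 0\<close> n by (meson half_gt_zero divide_pos_pos)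
      obtain d where d: "d \<in> D" "dist x d < e / n / 2"
        using D(2)[of "ball x (e / n / 2)"] \<open>e > 0\<close> n
        by (metis centre_in_ball divide_pos_pos empty_iff half_gt_zero mem_ball open_ball)
      have "norm (blinfun_inner_right x - blinfun_inner_right d) \<le> norm (x - d)"
        by (rule norm_blinfun_bound)
          (auto simp: blinfun.diff_left inner_diff_left[symmetric] Cauchy_Schwarz_ineq2)
      then have "norm ((blinfun_inner_right b o\<^sub>L f) - blinfun_inner_right d) < e / n"
        using x d(2) norm_triangle_ineq[of "(blinfun_inner_right b o\<^sub>L f) - blinfun_inner_right x"
            "blinfun_inner_right x - blinfun_inner_right d"]
        by (simp add: dist_norm)
      then show ?thesis using d(1) by blast
    qed
    then obtain d where d: "\<And>b. d b \<in> D"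
      "\<And>b. norm ((blinfun_inner_right b o\<^sub>L f) - blinfun_inner_right (d b)) < e / n"
      by metis
    let ?r = "\<lambda>b. (blinfun_inner_right b o\<^sub>L f) - blinfun_inner_right (d b)"
    have "f - J (restrict d Basis) = (\<Sum>b\<in>Basis. blinfun_scaleR_left b o\<^sub>L ?r b)"
    proof (rule blinfun_eqI)
      fix x
      have "blinfun_apply f x = (\<Sum>b\<in>Basis. inner b (blinfun_apply f x) *\<^sub>R b)"
        using euclidean_representation[of "blinfun_apply f x"] by (metis (no_types, lifting) inner_commute sum.cong)
      moreover have "blinfun_apply (f - J (restrict d Basis)) x
          = blinfun_apply f x - (\<Sum>b\<in>Basis. inner (d b) x *\<^sub>R b)"
        by (simp add: J_def blinfun.diff_left blinfun.sum_left)
      moreover have "blinfun_apply (\<Sum>b\<in>Basis. blinfun_scaleR_left b o\<^sub>L ?r b) x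
          = (\<Sum>b\<in>Basis. inner b (blinfun_apply f x) *\<^sub>R b) - (\<Sum>b\<in>Basis. inner (d b) x *\<^sub>R b)"
        by (simp add: blinfun.diff_left blinfun.sum_left scaleR_diff_left sum_subtractf)
      ultimately show "blinfun_apply (f - J (restrict d Basis)) x
          = blinfun_apply (\<Sum>b\<in>Basis. blinfun_scaleR_left b o\<^sub>L ?r b) x"
        by argo
    qed
    also have "norm \<dots> < (\<Sum>b\<in>(Basis :: 'b set). e / n)"
    proof (rule le_less_trans[OF norm_sum], rule sum_strict_mono)
      fix b :: 'b assume "b \<in> Basis"
      then have "norm (blinfun_scaleR_left b) \<le> 1"
        by (intro norm_blinfun_bound) auto
      then have "norm (blinfun_scaleR_left b o\<^sub>L ?r b) \<le> 1 * norm (?r b)"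
        by (intro order_trans[OF norm_blinfun_compose] mult_right_mono) auto
      then show "norm (blinfun_scaleR_left b o\<^sub>L ?r b) < e / n"
        using d(2)[of b] by linarith
    qed auto
    also have "\<dots> = e" using n by (simp add: n_def)
    finally have "dist f (J (restrict d Basis)) < e" by (simp add: dist_norm)
    then show ?thesis using d(1) by auto
  qed
  ultimately show "\<exists>B::('a \<Rightarrow>\<^sub>L 'b) set set. countable B \<and> open = generate_topology B"
    by (rule countable_dense_imp_countable_subbasis)
qed


section \<open>Bochner spaces\<close>

text \<open>
  Elements of Lebesgue and Bochner spaces are represented by functions; equality in such a space is
  equality almost everywhere. \<open>L\<^sup>2(0,T; L\<^sup>2(P; X))\<close> is \<open>L\<^sup>2((0,T) \<times> P; X)\<close>: its elements are
  represented by jointly measurable functions of time and of the random parameter.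
\<close>

definition L2_space :: "'w measure \<Rightarrow> ('w \<Rightarrow> 'x::real_normed_vector) set" where
  "L2_space P = {v \<in> borel_measurable P. integrable P (\<lambda>\<omega>. (norm (v \<omega>))\<^sup>2)}"

definition L2_norm :: "'w measure \<Rightarrow> ('w \<Rightarrow> 'x::real_normed_vector) \<Rightarrow> real" where
  "L2_norm P v = sqrt (\<integral>\<omega>. (norm (v \<omega>))\<^sup>2 \<partial>P)"

definition time_interval :: "real \<Rightarrow> real measure" where
  "time_interval T = restrict_space lborel {0..T}"

definition L2_time :: "'w measure \<Rightarrow> real \<Rightarrow> (real \<Rightarrow> 'w \<Rightarrow> 'x::real_normed_vector) set" where
  "L2_time P T = {w. (\<lambda>(t, \<omega>). w t \<omega>) \<in> L2_space (time_interval T \<Otimes>\<^sub>M P)}"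

definition L2_time_norm :: "'w measure \<Rightarrow> real \<Rightarrow> (real \<Rightarrow> 'w \<Rightarrow> 'x::real_normed_vector) \<Rightarrow> real" where
  "L2_time_norm P T w = sqrt (LINT t:{0..T}|lborel. (L2_norm P (w t))\<^sup>2)"

definition centered :: "'w measure \<Rightarrow> ('w \<Rightarrow> 'x::{banach, second_countable_topology}) \<Rightarrow> 'w \<Rightarrow> 'x" where
  "centered P v = (\<lambda>\<omega>. v \<omega> - (\<integral>\<omega>'. v \<omega>' \<partial>P))"

section \<open>Time derivatives\<close>

text \<open>
  \<open>g\<close> is the absolutely continuous representative of an element of \<open>W\<^sup>1\<^sup>,\<^sup>1(0,T; X)\<close> and \<open>dg\<close> is its
  weak derivative. In the second definition \<open>X = L\<^sup>2(P; 'x)\<close>, where the Bochner integral of \<open>dg\<close> over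
  \<open>[0,t]\<close> is computed pointwise in \<open>\<omega>\<close>.
\<close>

definition time_derivative ::
  "real \<Rightarrow> (real \<Rightarrow> 'x::{banach, second_countable_topology}) \<Rightarrow> (real \<Rightarrow> 'x) \<Rightarrow> bool" where
  "time_derivative T g dg \<longleftrightarrow>
     integrable (time_interval T) dg \<and>
     (\<forall>t\<in>{0..T}. g t = g 0 + (LINT s:{0..t}|lborel. dg s))"

definition time_derivative_L2 ::
  "'w measure \<Rightarrow> real \<Rightarrow> (real \<Rightarrow> 'w \<Rightarrow> 'x::{banach, second_countable_topology})
    \<Rightarrow> (real \<Rightarrow> 'w \<Rightarrow> 'x) \<Rightarrow> bool" where
  "time_derivative_L2 P T g dg \<longleftrightarrow>
     (\<lambda>(t, \<omega>). dg t \<omega>) \<in> borel_measurable (time_interval T \<Otimes>\<^sub>M P) \<and>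
     (AE t in time_interval T. dg t \<in> L2_space P) \<and>
     integrable (time_interval T) (\<lambda>t. L2_norm P (dg t)) \<and>
     (\<forall>t\<in>{0..T}. g t \<in> L2_space P \<and>
        (AE \<omega> in P. g t \<omega> = g 0 \<omega> + (LINT s:{0..t}|lborel. dg s \<omega>)))"

section \<open>Gelfand triple and random operator\<close>

text \<open>
  The inclusion of \<open>V\<close> into \<open>H\<close> is an explicit map \<open>E\<close>; \<open>H\<close> is identified with its own dual.
  Hence \<open>H_to_dual E h\<close> is the functional \<open>v \<mapsto> \<langle>h, E v\<rangle>\<close>, i.e. the image of \<open>h\<close> in \<open>V'\<close>.
\<close>

definition gelfand_triple :: "('v::real_inner \<Rightarrow>\<^sub>L 'h::real_inner) \<Rightarrow> bool" where
  "gelfand_triple E \<longleftrightarrow> inj (blinfun_apply E) \<and> closure (range (blinfun_apply E)) = UNIV"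

definition H_to_dual :: "('v::real_inner \<Rightarrow>\<^sub>L 'h::real_inner) \<Rightarrow> 'h \<Rightarrow> ('v \<Rightarrow>\<^sub>L real)" where
  "H_to_dual E h = blinfun_inner_right h o\<^sub>L E"

definition random_op ::
  "('w \<Rightarrow> ('v::real_inner \<Rightarrow>\<^sub>L ('v \<Rightarrow>\<^sub>L real))) \<Rightarrow> ('w \<Rightarrow> 'v) \<Rightarrow> 'w \<Rightarrow> ('v \<Rightarrow>\<^sub>L real)" where
  "random_op L v = (\<lambda>\<omega>. blinfun_apply (L \<omega>) (v \<omega>))"

definition energy_form ::
  "'w measure \<Rightarrow> ('w \<Rightarrow> ('v::real_inner \<Rightarrow>\<^sub>L ('v \<Rightarrow>\<^sub>L real))) \<Rightarrow> ('w \<Rightarrow> 'v) \<Rightarrow> ('w \<Rightarrow> 'v) \<Rightarrow> real" where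
  "energy_form P L v w = (\<integral>\<omega>. blinfun_apply (random_op L v \<omega>) (w \<omega>) \<partial>P)"

definition energy_norm ::
  "'w measure \<Rightarrow> ('w \<Rightarrow> ('v::real_inner \<Rightarrow>\<^sub>L ('v \<Rightarrow>\<^sub>L real))) \<Rightarrow> ('w \<Rightarrow> 'v) \<Rightarrow> real" where
  "energy_norm P L v = sqrt (energy_form P L v v)"

definition symmetric_op :: "'w measure \<Rightarrow> ('w \<Rightarrow> ('v::real_inner \<Rightarrow>\<^sub>L ('v \<Rightarrow>\<^sub>L real))) \<Rightarrow> bool" where
  "symmetric_op P L \<longleftrightarrow>
     (\<forall>v\<in>L2_space P. \<forall>w\<in>L2_space P. energy_form P L v w = energy_form P L w v)"

section \<open>Dynamical low-rank solutions\<close>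

definition gram :: "('v::real_inner \<Rightarrow>\<^sub>L 'h::real_inner) \<Rightarrow> ('r::finite \<Rightarrow> 'v) \<Rightarrow> real^'r^'r" where
  "gram E U = (\<chi> i j. inner (blinfun_apply E (U i)) (blinfun_apply E (U j)))"

definition proj_perp :: "'w measure \<Rightarrow> ('r::finite \<Rightarrow> 'w \<Rightarrow> real) \<Rightarrow> ('w \<Rightarrow> real) \<Rightarrow> 'w \<Rightarrow> real" where
  "proj_perp P Y v = (\<lambda>\<omega>. v \<omega> - (\<Sum>j\<in>UNIV. (\<integral>\<omega>'. v \<omega>' * Y j \<omega>' \<partial>P) * Y j \<omega>))"

text \<open>
  The rank is \<open>R = CARD('r)\<close>. The functions \<open>ubar\<close> and \<open>U i\<close> take values in \<open>V\<close>, their derivatives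
  \<open>dubar\<close> and \<open>dU i\<close> in \<open>V'\<close>; \<open>dY i\<close> is the derivative of \<open>Y i\<close> in \<open>L\<^sup>2(P)\<close>. Conditions that involve
  derivatives or the forcing hold for almost every time.
\<close>

definition DLR_solution ::
  "'w measure \<Rightarrow> real
   \<Rightarrow> ('v::{real_inner, banach, second_countable_topology}
        \<Rightarrow>\<^sub>L 'h::{real_inner, banach, second_countable_topology})
   \<Rightarrow> ('w \<Rightarrow> ('v \<Rightarrow>\<^sub>L ('v \<Rightarrow>\<^sub>L real))) \<Rightarrow> (real \<Rightarrow> 'w \<Rightarrow> 'h)
   \<Rightarrow> (real \<Rightarrow> 'v) \<Rightarrow> (real \<Rightarrow> ('v \<Rightarrow>\<^sub>L real))
   \<Rightarrow> ('r::finite \<Rightarrow> real \<Rightarrow> 'v) \<Rightarrow> ('r \<Rightarrow> real \<Rightarrow> ('v \<Rightarrow>\<^sub>L real))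
   \<Rightarrow> ('r \<Rightarrow> real \<Rightarrow> 'w \<Rightarrow> real) \<Rightarrow> ('r \<Rightarrow> real \<Rightarrow> 'w \<Rightarrow> real)
   \<Rightarrow> (real \<Rightarrow> 'w \<Rightarrow> 'v) \<Rightarrow> bool" where
  "DLR_solution P T E L f ubar dubar U dU Y dY u \<longleftrightarrow>
     time_derivative T (\<lambda>t. H_to_dual E (blinfun_apply E (ubar t))) dubar \<and>
     (\<forall>i. time_derivative T (\<lambda>t. H_to_dual E (blinfun_apply E (U i t))) (dU i)) \<and>
     (\<forall>i. time_derivative_L2 P T (Y i) (dY i)) \<and>
     (\<forall>t\<in>{0..T}.
        u t \<in> L2_space P \<and>
        (AE \<omega> in P. u t \<omega> = ubar t + (\<Sum>i\<in>UNIV. Y i t \<omega> *\<^sub>R U i t)) \<and>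
        inj (\<lambda>i. U i t) \<and> independent (range (\<lambda>i. U i t)) \<and>
        (\<forall>i j. (\<integral>\<omega>. Y i t \<omega> * Y j t \<omega> \<partial>P) = (if i = j then 1 else 0)) \<and>
        (\<forall>j. (\<integral>\<omega>. Y j t \<omega> \<partial>P) = 0)) \<and>
     (AE t in time_interval T.
        (\<forall>i j. (\<integral>\<omega>. dY i t \<omega> * Y j t \<omega> \<partial>P) = 0) \<and>
        (\<forall>v. blinfun_apply (dubar t) v
             + blinfun_apply (\<integral>\<omega>. random_op L (u t) \<omega> \<partial>P) v
             = inner (\<integral>\<omega>. f t \<omega> \<partial>P) (blinfun_apply E v)) \<and>
        (\<forall>j v. blinfun_apply (dU j t) v
             + blinfun_apply (\<integral>\<omega>. Y j t \<omega> *\<^sub>R random_op L (u t) \<omega> \<partial>P) v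
             = inner (\<integral>\<omega>. Y j t \<omega> *\<^sub>R f t \<omega> \<partial>P) (blinfun_apply E v)) \<and>
        (\<forall>j. AE \<omega> in P.
             dY j t \<omega>
             + (\<Sum>i\<in>UNIV. matrix_inv (gram E (\<lambda>k. U k t)) $ j $ i *
                  proj_perp P (\<lambda>k. Y k t)
                    (\<lambda>\<omega>'. blinfun_apply (centered P (random_op L (u t)) \<omega>') (U i t)
                         - inner (centered P (f t) \<omega>') (blinfun_apply E (U i t))) \<omega>)
             = 0))"

end

theory Submission
  imports Defs
begin

text \<open>
  Put \<open>r = u' + L u - f\<close>. The equations for the mean and the modes say that \<open>\<integral> r = 0\<close> and
  \<open>\<integral> Y\<^sub>j r = 0\<close> in \<open>V'\<close>; the equation for \<open>Y'\<close>, multiplied by the Gram matrix, says that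
  \<open>r(U\<^sub>i)\<close> lies in the span of 1 and the \<open>Y\<^sub>k\<close>, hence is orthogonal to every \<open>Y'\<^sub>j\<close>. So \<open>r\<close> vanishes
  on the tangent space, which contains \<open>u\<close> and, by the product rule, also \<open>u'\<close>: since \<open>u'\<close> takes
  values in \<open>V\<close>, so do the derivatives of the mean and of the modes. Testing with \<open>u\<close> controls the
  derivative of \<open>\<parallel>u\<parallel>\<^sub>H\<close>, testing with \<open>u'\<close> that of the energy norm. The time derivatives are
  handled for fixed \<open>\<omega>\<close>, where \<open>u\<close> is absolutely continuous, and then integrated over \<open>\<omega>\<close>.
\<close>

section \<open>Primitives of integrable functions of time\<close>

text \<open>Both norms come from one chain rule: \<open>energy_form_derivative\<close> is used with
  \<open>K = L\<close> and with \<open>K = H_form E\<close>, the H inner product seen as an operator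
  from V to V'. It assumes no symmetry and yields two cross terms; in the energy estimate symmetry
  of L merges them into twice the term that testing with u' controls. Null sets shape the proof. For
  each t the identity u(t) = u(0) + int u' holds off a null set that depends on t, so u itself need
  not have continuous paths. Paths are therefore replaced by primitives, which are continuous in t
  and jointly measurable, and Fubini on the product of time and probability space exchanges the two
  kinds of exceptional sets. That Y'_j has zero mean is not one of the DLR conditions; it is read
  off from the Y equation, where a centred quantity is projected orthogonally to the centred Y_k.
  The constant \<open>C_P\<^sup>2 / C_L\<close> comes from Young's inequality: coercivity offers 2
  C_L |u|^2, one half of which absorbs the forcing while the other half stays on the left.\<close>

lemma space_time_interval [simp]: "space (time_interval T) = {0..T}"
  by (simp add: time_interval_def space_restrict_space)

lemma measurable_time_interval_iff:
  "f \<in> measurable (time_interval T) N \<longleftrightarrow> f \<in> measurable (restrict_space borel {0..T}) N"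
  unfolding time_interval_def by (intro measurable_cong_sets[THEN arg_cong[where f="\<lambda>S. f \<in> S"]] sets_restrict_space_cong) auto

lemma measurable_ident_time_interval [measurable]: "(\<lambda>t. t) \<in> borel_measurable (time_interval T)"
  by (simp add: measurable_time_interval_iff measurable_restrict_space1)

lemma finite_measure_time_interval: "finite_measure (time_interval T)"
proof
  show "emeasure (time_interval T) (space (time_interval T)) \<noteq> \<infinity>"
    by (cases "0 \<le> T") (simp_all add: time_interval_def emeasure_restrict_space)
qed

lemma AE_time_interval_neq: "AE s in time_interval T. s \<noteq> t"
  unfolding time_interval_def by (subst AE_restrict_space_iff) (auto intro: AE_mp[OF AE_lborel_singleton[of t]])

lemma set_integral_time_interval:
  fixes g :: "real \<Rightarrow> 'x::{banach, second_countable_topology}"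
  assumes "A \<subseteq> {0..T}"
  shows "(LINT s:A|lborel. g s) = (LINT s:A|time_interval T. g s)"
  unfolding set_lebesgue_integral_def time_interval_def using assms
  by (subst integral_restrict_space) (auto intro!: Bochner_Integration.integral_cong split: split_indicator)

lemma set_integral_time_interval_full:
  fixes g :: "real \<Rightarrow> 'x::{banach, second_countable_topology}"
  shows "(LINT s:{0..T}|lborel. g s) = (\<integral>s. g s \<partial>time_interval T)"
  unfolding set_lebesgue_integral_def time_interval_def
  by (subst integral_restrict_space) auto

text \<open>Integration runs over \<open>time_interval T\<close>, so the function is total in t: it
  is 0 for t < 0 and constant from T on. Continuity and rational times can thus be discussed on the
  whole line although \<open>g\<close> matters on [0,T] only.\<close>

definition primitive :: "real \<Rightarrow> (real \<Rightarrow> 'x::{banach, second_countable_topology}) \<Rightarrow> real \<Rightarrow> 'x" where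
  "primitive T g t = (LINT s:{0..t}|time_interval T. g s)"

lemma primitive_eq: "t \<le> T \<Longrightarrow> (LINT s:{0..t}|lborel. g s) = primitive T g t"
  unfolding primitive_def by (rule set_integral_time_interval) auto

lemma Icc_inter_sets_time_interval [measurable]: "{a..b} \<inter> {0..T} \<in> sets (time_interval T)"
  unfolding time_interval_def sets_restrict_space by (intro image_eqI[where x="{a..b}"]) (auto simp del: Int_atLeastAtMost)

lemma integrable_indicator_time:
  fixes g :: "real \<Rightarrow> 'x::{banach, second_countable_topology}"
  assumes "integrable (time_interval T) g"
  shows "integrable (time_interval T) (\<lambda>s. indicator {a..b} s *\<^sub>R g s)"
proof -
  have "integrable (time_interval T) (\<lambda>s. indicator ({a..b} \<inter> {0..T}) s *\<^sub>R g s)"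
    by (rule integrable_mult_indicator[OF Icc_inter_sets_time_interval assms])
  then show ?thesis
    by (rule Bochner_Integration.integrable_cong[THEN iffD1, rotated -1]) (auto split: split_indicator)
qed

lemma primitive_negative: "t < 0 \<Longrightarrow> primitive T g t = 0"
  by (simp add: primitive_def set_lebesgue_integral_def)

lemma primitive_beyond: "T \<le> t \<Longrightarrow> primitive T g t = primitive T g T"
  unfolding primitive_def set_lebesgue_integral_def
  by (rule Bochner_Integration.integral_cong) (auto split: split_indicator)

lemma primitive_cong_AE:
  assumes "g \<in> borel_measurable (time_interval T)" "h \<in> borel_measurable (time_interval T)"
    "AE s in time_interval T. g s = h s"
  shows "primitive T g t = primitive T h t"
  unfolding primitive_def set_lebesgue_integral_def
  by (rule integral_cong_AE) (use assms in \<open>auto elim: AE_mp\<close>)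

lemma primitive_add:
  assumes "integrable (time_interval T) g" "integrable (time_interval T) h"
  shows "primitive T (\<lambda>s. g s + h s) t = primitive T g t + primitive T h t"
  unfolding primitive_def set_lebesgue_integral_def scaleR_add_right
  by (intro Bochner_Integration.integral_add integrable_indicator_time assms)

lemma primitive_diff:
  assumes "integrable (time_interval T) g" "integrable (time_interval T) h"
  shows "primitive T (\<lambda>s. g s - h s) t = primitive T g t - primitive T h t"
  unfolding primitive_def set_lebesgue_integral_def scaleR_diff_right
  by (intro Bochner_Integration.integral_diff integrable_indicator_time assms)

lemma primitive_sum:
  assumes "\<And>i. i \<in> I \<Longrightarrow> integrable (time_interval T) (g i)"
  shows "primitive T (\<lambda>s. \<Sum>i\<in>I. g i s) t = (\<Sum>i\<in>I. primitive T (g i) t)"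
  unfolding primitive_def set_lebesgue_integral_def scaleR_sum_right
  by (intro Bochner_Integration.integral_sum integrable_indicator_time assms)

lemma primitive_bounded_linear:
  assumes "bounded_linear F" "integrable (time_interval T) g"
  shows "primitive T (\<lambda>s. F (g s)) t = F (primitive T g t)"
proof -
  interpret bounded_linear F by fact
  show ?thesis
    unfolding primitive_def set_lebesgue_integral_def
    by (simp flip: scaleR add: integral_bounded_linear[OF assms(1) integrable_indicator_time[OF assms(2)]])
qed

text \<open>An integral over s with parameters t and \<omega>: with the indicator written out as the
  condition 0 <= s <= t, the integrand is jointly measurable in all three variables.\<close>

lemma measurable_primitive:
  fixes g :: "'w \<Rightarrow> real \<Rightarrow> 'x::{banach, second_countable_topology}"
  assumes g [measurable]: "(\<lambda>(s, \<omega>). g \<omega> s) \<in> borel_measurable (time_interval T \<Otimes>\<^sub>M P)"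
  shows "(\<lambda>(t, \<omega>). primitive T (g \<omega>) t) \<in> borel_measurable (time_interval T \<Otimes>\<^sub>M P)"
proof -
  interpret finite_measure "time_interval T" by (rule finite_measure_time_interval)
  have [measurable]: "(\<lambda>x. g (snd (fst x)) (snd x))
      \<in> borel_measurable ((time_interval T \<Otimes>\<^sub>M P) \<Otimes>\<^sub>M time_interval T)"
    using measurable_compose[OF _ g, of "\<lambda>x. (snd x, snd (fst x))"] by simp
  show ?thesis
    unfolding primitive_def set_lebesgue_integral_def split_beta' indicator_def atLeastAtMost_iff
    by measurable
qed

lemma primitive_measurable:
  fixes g :: "real \<Rightarrow> 'x::{banach, second_countable_topology}"
  assumes [measurable]: "g \<in> borel_measurable (time_interval T)"
  shows "primitive T g \<in> borel_measurable (time_interval T)"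
proof -
  interpret finite_measure "time_interval T" by (rule finite_measure_time_interval)
  show ?thesis
    unfolding primitive_def[abs_def] set_lebesgue_integral_def indicator_def atLeastAtMost_iff
    by measurable
qed

text \<open>Dominated convergence with bound \<open>norm (g s)\<close>: if x n tends to t, the
  indicators of {0..x n} are eventually constant at every s other than the single point t.\<close>

lemma primitive_continuous:
  fixes g :: "real \<Rightarrow> 'x::{banach, second_countable_topology}"
  assumes g: "integrable (time_interval T) g"
  shows "continuous_on UNIV (primitive T g)"
proof (rule continuous_at_imp_continuous_on, intro ballI, unfold continuous_at_sequentially, intro allI impI)
  fix t and x :: "nat \<Rightarrow> real" assume x: "x \<longlonglongrightarrow> t"
  show "(primitive T g \<circ> x) \<longlonglongrightarrow> primitive T g t"
    unfolding primitive_def set_lebesgue_integral_def o_def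
  proof (rule integral_dominated_convergence[where w = "\<lambda>s. norm (g s)"])
    show "AE s in time_interval T. (\<lambda>n. indicator {0..x n} s *\<^sub>R g s) \<longlonglongrightarrow> indicator {0..t} s *\<^sub>R g s"
      using AE_time_interval_neq[where T=T and t=t] AE_space[of "time_interval T"]
    proof eventually_elim
      case (elim s)
      show ?case
      proof (cases "s < t")
        case True
        then have "\<forall>\<^sub>F n in sequentially. s < x n" using x order_tendstoD(1) by blast
        then have "\<forall>\<^sub>F n in sequentially. indicator {0..x n} s *\<^sub>R g s = indicator {0..t} s *\<^sub>R g s"
          by eventually_elim (use True elim in auto)
        then show ?thesis by (rule tendsto_eventually)
      next
        case False
        then have "t < s" using elim by auto
        then have "\<forall>\<^sub>F n in sequentially. x n < s" using x order_tendstoD(2) by blast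
        then have "\<forall>\<^sub>F n in sequentially. indicator {0..x n} s *\<^sub>R g s = indicator {0..t} s *\<^sub>R g s"
          by eventually_elim (use \<open>t < s\<close> elim in auto)
        then show ?thesis by (rule tendsto_eventually)
      qed
    qed
  qed (use g integrable_indicator_time[OF g] in \<open>auto split: split_indicator\<close>)
qed

text \<open>An integrable function is determined almost everywhere by its primitive. By continuity
  rational times suffice, and this countability later allows one null set of \<omega> to serve all
  times.\<close>

lemma AE_zero_of_primitive_zero:
  fixes h :: "real \<Rightarrow> 'x::{banach, second_countable_topology}"
  assumes h: "integrable (time_interval T) h"
    and zero: "\<And>q. q \<in> \<rat> \<Longrightarrow> primitive T h q = 0"
  shows "AE s in time_interval T. h s = 0"
proof -
  have closed: "closed {t. primitive T h t = 0}"
    using continuous_closed_preimage_constant[OF primitive_continuous[OF h], of 0] by simp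
  have "closure \<rat> \<subseteq> {t. primitive T h t = 0}"
    using zero by (intro closure_minimal closed) auto
  then have zero': "primitive T h t = 0" for t
    using Rats_closure_real by auto
  \<comment> \<open>Extension by zero turns integrals over half-lines {..t} into values of the
    primitive at \<open>min t T\<close>.\<close>
  define h' where "h' = (\<lambda>s. indicator {0..T} s *\<^sub>R h s)"
  have h': "integrable lborel h'"
    using h unfolding h'_def time_interval_def by (subst (asm) integrable_restrict_space) auto
  have gen: "set_lebesgue_integral lborel {..t} h' = 0" for t
  proof -
    have "set_lebesgue_integral lborel {..t} h' = (LINT s:{0..min t T}|lborel. h s)"
      unfolding set_lebesgue_integral_def h'_def
      by (rule Bochner_Integration.integral_cong) (auto split: split_indicator)
    also have "\<dots> = primitive T h (min t T)" by (rule primitive_eq) simp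
    finally show ?thesis by (simp add: zero')
  qed
  have "set_lebesgue_integral lborel A h' = 0" if "A \<in> sets lborel" for A
  proof -
    have int: "set_integrable lborel B h'" if "B \<in> sets lborel" for B
      unfolding set_integrable_def using that h' by (intro integrable_mult_indicator)
    have tot: "set_lebesgue_integral lborel UNIV h' = 0"
    proof -
      have "h' = (\<lambda>s. indicator {..T} s *\<^sub>R h' s)" by (auto simp: h'_def split: split_indicator)
      then show ?thesis using gen[of T] by (simp add: set_lebesgue_integral_def)
    qed
    \<comment> \<open>Half-lines are stable under intersection and generate the Borel sets, so
      vanishing of the integral spreads to all Borel sets by a pi-lambda argument;
      \<open>tot\<close> feeds the complement case.\<close>
    have sets_eq: "sets lborel = sigma_sets UNIV (range (atMost :: real \<Rightarrow> _))"
      by (simp add: borel_eq_atMost)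
    have "Int_stable (range (atMost :: real \<Rightarrow> _))" by (auto simp: Int_stable_def)
    moreover have "range (atMost :: real \<Rightarrow> _) \<subseteq> Pow UNIV" by auto
    moreover have "A \<in> sigma_sets UNIV (range (atMost :: real \<Rightarrow> _))" using that sets_eq by simp
    ultimately show ?thesis
    proof (induct rule: sigma_sets_induct_disjoint)
      case (basic B) then show ?case using gen by auto
    next
      case empty show ?case by (simp add: set_lebesgue_integral_def)
    next
      case (compl B)
      then have B: "B \<in> sets lborel" using sets_eq by simp
      have "(LINT s|lborel. indicator UNIV s *\<^sub>R h' s - indicator B s *\<^sub>R h' s)
          = set_lebesgue_integral lborel UNIV h' - set_lebesgue_integral lborel B h'"
        unfolding set_lebesgue_integral_def using int[OF B] h'
        by (intro Bochner_Integration.integral_diff) (auto simp: set_integrable_def)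
      moreover have "set_lebesgue_integral lborel (UNIV - B) h'
          = (LINT s|lborel. indicator UNIV s *\<^sub>R h' s - indicator B s *\<^sub>R h' s)"
        unfolding set_lebesgue_integral_def
        by (intro Bochner_Integration.integral_cong) (auto split: split_indicator)
      ultimately show ?case using compl tot by simp
    next
      case (union B)
      then have B: "\<And>i. B i \<in> sets lborel" using sets_eq by auto
      have "set_lebesgue_integral lborel (\<Union>i. B i) h' = (\<Sum>i. set_lebesgue_integral lborel (B i) h')"
        using B union(1) by (intro lebesgue_integral_countable_add int) (auto simp: disjoint_family_on_def)
      then show ?case using union by simp
    qed
  qed
  then have "AE s in lborel. h' s = 0" by (rule sigma_finite_measure.density_zero[OF lborel.sigma_finite_measure_axioms h'])
  then show ?thesis
    unfolding time_interval_def by (subst AE_restrict_space_iff) (auto simp: h'_def elim: AE_mp)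
qed

section \<open>Integration by parts for primitives\<close>

lemma borel_measurable_bounded_bilinear:
  fixes B :: "'a::{real_normed_vector, second_countable_topology} \<Rightarrow>
    'b::{real_normed_vector, second_countable_topology} \<Rightarrow> 'c::real_normed_vector"
  assumes B: "bounded_bilinear B" and g: "g \<in> borel_measurable M" and h: "h \<in> borel_measurable M"
  shows "(\<lambda>x. B (g x) (h x)) \<in> borel_measurable M"
  by (rule borel_measurable_continuous_Pair[OF g h])
    (intro bounded_bilinear.continuous_on[OF B] continuous_intros)

lemma integrable_bilinear_pair:
  fixes B :: "'a::{banach, second_countable_topology} \<Rightarrow> 'b::{banach, second_countable_topology}
    \<Rightarrow> 'c::{banach, second_countable_topology}"
  assumes B: "bounded_bilinear B" and "sigma_finite_measure M" "sigma_finite_measure N"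
    and g: "integrable M g" and h: "integrable N h"
  shows "integrable (M \<Otimes>\<^sub>M N) (\<lambda>(s, r). B (g s) (h r))"
proof -
  interpret sigma_finite_measure M by fact
  interpret N: sigma_finite_measure N by fact
  interpret pair_sigma_finite M N ..
  obtain K where K: "\<And>a b. norm (B a b) \<le> norm a * norm b * K"
    using bounded_bilinear.bounded[OF B] by blast
  have [measurable]: "g \<in> borel_measurable M" "h \<in> borel_measurable N" using g h by auto
  have "integrable (M \<Otimes>\<^sub>M N) (\<lambda>(s, r). norm (g s) * norm (h r) * K)"
    by (rule Fubini_integrable) (use g h in \<open>auto simp: abs_mult mult.assoc\<close>)
  then show ?thesis
  proof (rule Bochner_Integration.integrable_bound)
    show "(\<lambda>(s, r). B (g s) (h r)) \<in> borel_measurable (M \<Otimes>\<^sub>M N)"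
      unfolding split_beta' by (intro borel_measurable_bounded_bilinear[OF B]) measurable
  qed (auto intro!: AE_I2 order_trans[OF K])
qed

text \<open>Fubini on the square [0,t] x [0,t] for \<open>B (g s) (h r)\<close>: cut along the
  diagonal, each triangle has a primitive as its inner integral. Integrability of \<open>g\<close>
  and \<open>h\<close> is enough, with no pointwise derivative involved.\<close>

lemma primitive_product:
  fixes B :: "'a::{banach, second_countable_topology} \<Rightarrow> 'b::{banach, second_countable_topology}
    \<Rightarrow> 'c::{banach, second_countable_topology}"
  assumes B: "bounded_bilinear B"
    and g: "integrable (time_interval T) g" and h: "integrable (time_interval T) h"
  shows "integrable (time_interval T) (\<lambda>s. B (g s) (primitive T h s))"
    and "integrable (time_interval T) (\<lambda>s. B (primitive T g s) (h s))"
    and "B (primitive T g t) (primitive T h t)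
      = primitive T (\<lambda>s. B (g s) (primitive T h s)) t + primitive T (\<lambda>s. B (primitive T g s) (h s)) t"
proof -
  let ?M = "time_interval T"
  interpret M: finite_measure ?M by (rule finite_measure_time_interval)
  interpret MM: pair_sigma_finite ?M ?M ..
  note [simp] = bounded_bilinear.scaleR_left[OF B] bounded_bilinear.scaleR_right[OF B]
  note left = bounded_bilinear.bounded_linear_left[OF B]
  note right = bounded_bilinear.bounded_linear_right[OF B]
  have F: "integrable (?M \<Otimes>\<^sub>M ?M) (\<lambda>(s, r). B (g s) (h r))"
    by (intro integrable_bilinear_pair B g h M.sigma_finite_measure_axioms)
  define W where "W = (\<lambda>A (s, r). (indicator A (s, r) :: real) *\<^sub>R B (g s) (h r))"
  \<comment> \<open>The first coordinate s belongs to \<open>g\<close>, the second coordinate r to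
    \<open>h\<close>. The triangles share the diagonal, which is null in the product, so their
    indicators add up to that of the square almost everywhere.\<close>
  define lower where "lower = (\<lambda>t. {(s, r). 0 \<le> r \<and> r \<le> s \<and> 0 \<le> s \<and> s \<le> (t::real)})"
  define upper where "upper = (\<lambda>t. {(s, r). 0 \<le> s \<and> s \<le> r \<and> 0 \<le> r \<and> r \<le> (t::real)})"
  have W: "integrable (?M \<Otimes>\<^sub>M ?M) (W A)" if "A \<inter> space (?M \<Otimes>\<^sub>M ?M) \<in> sets (?M \<Otimes>\<^sub>M ?M)" for A
  proof -
    have "integrable (?M \<Otimes>\<^sub>M ?M) (\<lambda>x. indicator (A \<inter> space (?M \<Otimes>\<^sub>M ?M)) x *\<^sub>R (\<lambda>(s, r). B (g s) (h r)) x)"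
      using that by (intro integrable_mult_indicator F)
    then show ?thesis
      by (rule Bochner_Integration.integrable_cong[THEN iffD1, rotated -1])
        (auto simp: W_def split: split_indicator)
  qed
  have sets: "lower t \<inter> space (?M \<Otimes>\<^sub>M ?M) \<in> sets (?M \<Otimes>\<^sub>M ?M)"
    "upper t \<inter> space (?M \<Otimes>\<^sub>M ?M) \<in> sets (?M \<Otimes>\<^sub>M ?M)"
    "({0..t} \<times> {0..t}) \<inter> space (?M \<Otimes>\<^sub>M ?M) \<in> sets (?M \<Otimes>\<^sub>M ?M)" for t
  proof -
    have "{x \<in> space (?M \<Otimes>\<^sub>M ?M). 0 \<le> snd x \<and> snd x \<le> fst x \<and> 0 \<le> fst x \<and> fst x \<le> t} \<in> sets (?M \<Otimes>\<^sub>M ?M)"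
      by measurable
    then show "lower t \<inter> space (?M \<Otimes>\<^sub>M ?M) \<in> sets (?M \<Otimes>\<^sub>M ?M)"
      by (rule back_subst[of "\<lambda>A. A \<in> sets _"]) (auto simp: lower_def)
    have "{x \<in> space (?M \<Otimes>\<^sub>M ?M). 0 \<le> fst x \<and> fst x \<le> snd x \<and> 0 \<le> snd x \<and> snd x \<le> t} \<in> sets (?M \<Otimes>\<^sub>M ?M)"
      by measurable
    then show "upper t \<inter> space (?M \<Otimes>\<^sub>M ?M) \<in> sets (?M \<Otimes>\<^sub>M ?M)"
      by (rule back_subst[of "\<lambda>A. A \<in> sets _"]) (auto simp: upper_def)
    have "{x \<in> space (?M \<Otimes>\<^sub>M ?M). 0 \<le> fst x \<and> fst x \<le> t \<and> 0 \<le> snd x \<and> snd x \<le> t} \<in> sets (?M \<Otimes>\<^sub>M ?M)"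
      by measurable
    then show "({0..t} \<times> {0..t}) \<inter> space (?M \<Otimes>\<^sub>M ?M) \<in> sets (?M \<Otimes>\<^sub>M ?M)"
      by (rule back_subst[of "\<lambda>A. A \<in> sets _"]) auto
  qed
  have low: "(\<integral>r. W (lower t) (s, r) \<partial>?M) = indicator {0..t} s *\<^sub>R B (g s) (primitive T h s)" for s t
    unfolding primitive_def set_lebesgue_integral_def W_def lower_def
    by (subst integral_bounded_linear[OF right, symmetric])
      (use integrable_indicator_time[OF h] in \<open>auto split: split_indicator intro!: Bochner_Integration.integral_cong
        simp flip: integral_scaleR_right\<close>)
  have up: "(\<integral>s. W (upper t) (s, r) \<partial>?M) = indicator {0..t} r *\<^sub>R B (primitive T g r) (h r)" for r t
    unfolding primitive_def set_lebesgue_integral_def W_def upper_def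
    by (subst integral_bounded_linear[OF left, symmetric])
      (use integrable_indicator_time[OF g] in \<open>auto split: split_indicator intro!: Bochner_Integration.integral_cong
        simp flip: integral_scaleR_right\<close>)
  have sq: "(\<integral>r. W ({0..t} \<times> {0..t}) (s, r) \<partial>?M) = indicator {0..t} s *\<^sub>R B (g s) (primitive T h t)" for s t
    unfolding primitive_def set_lebesgue_integral_def W_def
    by (subst integral_bounded_linear[OF right, symmetric])
      (use integrable_indicator_time[OF h] in \<open>auto split: split_indicator intro!: Bochner_Integration.integral_cong
        simp flip: integral_scaleR_right\<close>)
  \<comment> \<open>For t = T the indicator is 1 on the whole interval, so Fubini's integrability of
    the inner integrals is the claim.\<close>
  have "integrable ?M (\<lambda>s. indicator {0..T} s *\<^sub>R B (g s) (primitive T h s))"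
    using MM.integrable_fst'[OF W[OF sets(1)[of T]]] by (simp add: low)
  then show "integrable ?M (\<lambda>s. B (g s) (primitive T h s))"
    by (rule Bochner_Integration.integrable_cong[THEN iffD1, rotated -1]) auto
  have up_split: "integrable (?M \<Otimes>\<^sub>M ?M) (case_prod (\<lambda>s r. W (upper t) (s, r)))" for t
    using W[OF sets(2)[of t]] by simp
  have "integrable ?M (\<lambda>s. indicator {0..T} s *\<^sub>R B (primitive T g s) (h s))"
    using MM.integrable_snd[OF up_split[of T]] by (simp add: up)
  then show "integrable ?M (\<lambda>s. B (primitive T g s) (h s))"
    by (rule Bochner_Integration.integrable_cong[THEN iffD1, rotated -1]) auto
  have "B (primitive T g t) (primitive T h t) = (\<integral>s. \<integral>r. W ({0..t} \<times> {0..t}) (s, r) \<partial>?M \<partial>?M)"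
    unfolding sq using integral_bounded_linear[OF left integrable_indicator_time[OF g]]
    by (simp add: primitive_def set_lebesgue_integral_def)
  also have "\<dots> = integral\<^sup>L (?M \<Otimes>\<^sub>M ?M) (W ({0..t} \<times> {0..t}))"
    by (rule MM.integral_fst'[OF W[OF sets(3)]])
  also have "\<dots> = (\<integral>x. W (lower t) x + W (upper t) x \<partial>(?M \<Otimes>\<^sub>M ?M))"
  proof (rule integral_cong_AE)
    have "AE x in ?M \<Otimes>\<^sub>M ?M. fst x \<noteq> snd x"
    proof (rule MM.AE_pair_measure)
      show "AE x in ?M. AE y in ?M. fst (x, y) \<noteq> snd (x, y)"
        using AE_time_interval_neq[where T=T] by (auto intro!: AE_I2 simp: eq_commute)
    qed measurable
    then show "AE x in ?M \<Otimes>\<^sub>M ?M. W ({0..t} \<times> {0..t}) x = W (lower t) x + W (upper t) x"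
      by eventually_elim (auto simp: W_def lower_def upper_def split: split_indicator)
  qed (use W[OF sets(1)[of t]] W[OF sets(2)[of t]] W[OF sets(3)[of t]] in auto)
  also have "\<dots> = integral\<^sup>L (?M \<Otimes>\<^sub>M ?M) (W (lower t)) + integral\<^sup>L (?M \<Otimes>\<^sub>M ?M) (W (upper t))"
    by (intro Bochner_Integration.integral_add W sets)
  also have "integral\<^sup>L (?M \<Otimes>\<^sub>M ?M) (W (lower t)) = (\<integral>s. \<integral>r. W (lower t) (s, r) \<partial>?M \<partial>?M)"
    by (rule MM.integral_fst'[OF W[OF sets(1)], symmetric])
  also have "\<dots> = primitive T (\<lambda>s. B (g s) (primitive T h s)) t"
    by (simp add: low primitive_def set_lebesgue_integral_def)
  also have "integral\<^sup>L (?M \<Otimes>\<^sub>M ?M) (W (upper t)) = (\<integral>r. \<integral>s. W (upper t) (s, r) \<partial>?M \<partial>?M)"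
    using MM.integral_snd[OF up_split] by simp
  also have "\<dots> = primitive T (\<lambda>s. B (primitive T g s) (h s)) t"
    by (simp add: up primitive_def set_lebesgue_integral_def)
  finally show "B (primitive T g t) (primitive T h t)
      = primitive T (\<lambda>s. B (g s) (primitive T h s)) t + primitive T (\<lambda>s. B (primitive T g s) (h s)) t" .
qed

text \<open>Product rule for an initial value plus a primitive, the form in which every time
  derivative occurs here. After bilinear expansion the mixed terms with \<open>a\<close> and
  \<open>b\<close> are bounded linear images of primitives, and the remaining term is integration by
  parts.\<close>

lemma primitive_product_affine:
  fixes B :: "'a::{banach, second_countable_topology} \<Rightarrow> 'b::{banach, second_countable_topology}
    \<Rightarrow> 'c::{banach, second_countable_topology}"
  assumes B: "bounded_bilinear B"
    and g: "integrable (time_interval T) g" and h: "integrable (time_interval T) h"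
    and G: "\<And>t. G t = a + primitive T g t" and H: "\<And>t. H t = b + primitive T h t"
  shows "integrable (time_interval T) (\<lambda>s. B (g s) (H s) + B (G s) (h s))"
    and "B (G t) (H t) = B a b + primitive T (\<lambda>s. B (g s) (H s) + B (G s) (h s)) t"
proof -
  note simps = bounded_bilinear.add_left[OF B] bounded_bilinear.add_right[OF B]
  note left = bounded_bilinear.bounded_linear_left[OF B]
  note right = bounded_bilinear.bounded_linear_right[OF B]
  note P = primitive_product[OF B g h]
  have int: "integrable (time_interval T) (\<lambda>s. B (g s) b)" "integrable (time_interval T) (\<lambda>s. B a (h s))"
    by (intro integrable_bounded_linear[OF left] g integrable_bounded_linear[OF right] h)+
  show "integrable (time_interval T) (\<lambda>s. B (g s) (H s) + B (G s) (h s))"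
    unfolding G H simps by (intro Bochner_Integration.integrable_add int P)
  show "B (G t) (H t) = B a b + primitive T (\<lambda>s. B (g s) (H s) + B (G s) (h s)) t"
    unfolding G H simps
    by (subst primitive_add primitive_add[OF int(1) P(1)] primitive_add[OF int(2) P(2)]
        | intro Bochner_Integration.integrable_add int P)+
      (simp add: P(3) primitive_bounded_linear[OF left g] primitive_bounded_linear[OF right h])
qed

section \<open>Square integrable functions and the energy form\<close>

lemma L2_spaceD:
  assumes "v \<in> L2_space P"
  shows "v \<in> borel_measurable P" "integrable P (\<lambda>\<omega>. (norm (v \<omega>))\<^sup>2)"
  using assms by (auto simp: L2_space_def)

lemma L2_space_bound:
  fixes w :: "'w \<Rightarrow> 'x::real_normed_vector"
  assumes "w \<in> L2_space P" "v \<in> borel_measurable P"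
    and "AE \<omega> in P. norm (v \<omega>) \<le> C * norm (w \<omega>)"
  shows "v \<in> L2_space P"
proof -
  have "integrable P (\<lambda>\<omega>. (norm (v \<omega>))\<^sup>2)"
  proof (rule Bochner_Integration.integrable_bound)
    show "integrable P (\<lambda>\<omega>. C\<^sup>2 * (norm (w \<omega>))\<^sup>2)"
      using L2_spaceD(2)[OF assms(1)] by simp
    show "(\<lambda>\<omega>. (norm (v \<omega>))\<^sup>2) \<in> borel_measurable P" using assms(2) by measurable
    show "AE \<omega> in P. norm ((norm (v \<omega>))\<^sup>2) \<le> norm (C\<^sup>2 * (norm (w \<omega>))\<^sup>2)"
      using assms(3) by eventually_elim (auto simp flip: power_mult_distrib intro!: power_mono)
  qed
  then show ?thesis using assms(2) by (simp add: L2_space_def)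
qed

lemma L2_space_bounded_linear:
  assumes "bounded_linear F" "v \<in> L2_space P"
  shows "(\<lambda>\<omega>. F (v \<omega>)) \<in> L2_space P"
proof -
  obtain K where K: "\<And>x. norm (F x) \<le> norm x * K"
    using bounded_linear.bounded[OF assms(1)] by blast
  show ?thesis
  proof (rule L2_space_bound[OF assms(2), where C = K])
    show "(\<lambda>\<omega>. F (v \<omega>)) \<in> borel_measurable P"
      by (rule measurable_compose[OF L2_spaceD(1)[OF assms(2)]
            borel_measurable_continuous_onI[OF linear_continuous_on[OF assms(1)]]])
  qed (simp add: K mult.commute[of K])
qed

lemma L2_space_add:
  fixes v w :: "'w \<Rightarrow> 'x::{real_normed_vector, second_countable_topology}"
  assumes "v \<in> L2_space P" "w \<in> L2_space P"
  shows "(\<lambda>\<omega>. v \<omega> + w \<omega>) \<in> L2_space P"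
proof -
  note [measurable] = L2_spaceD(1)[OF assms(1)] L2_spaceD(1)[OF assms(2)]
  have "integrable P (\<lambda>\<omega>. (norm (v \<omega> + w \<omega>))\<^sup>2)"
  proof (rule Bochner_Integration.integrable_bound)
    show "integrable P (\<lambda>\<omega>. 2 * (norm (v \<omega>))\<^sup>2 + 2 * (norm (w \<omega>))\<^sup>2)"
      using assms[THEN L2_spaceD(2)] by simp
    have "(norm (v \<omega> + w \<omega>))\<^sup>2 \<le> 2 * (norm (v \<omega>))\<^sup>2 + 2 * (norm (w \<omega>))\<^sup>2" for \<omega>
    proof -
      have "(norm (v \<omega> + w \<omega>))\<^sup>2 \<le> (norm (v \<omega>) + norm (w \<omega>))\<^sup>2"
        by (intro power_mono norm_triangle_ineq) simp
      also have "\<dots> \<le> 2 * (norm (v \<omega>))\<^sup>2 + 2 * (norm (w \<omega>))\<^sup>2"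
        using sum_squares_bound[of "norm (v \<omega>)" "norm (w \<omega>)"] by (simp add: power2_sum)
      finally show ?thesis .
    qed
    then show "AE \<omega> in P. norm ((norm (v \<omega> + w \<omega>))\<^sup>2) \<le> norm (2 * (norm (v \<omega>))\<^sup>2 + 2 * (norm (w \<omega>))\<^sup>2)"
      by simp
  qed measurable
  then show ?thesis by (simp add: L2_space_def)
qed

lemma L2_space_minus:
  assumes "v \<in> L2_space P" shows "(\<lambda>\<omega>. - v \<omega>) \<in> L2_space P"
  using assms by (intro L2_space_bounded_linear[OF bounded_linear_minus[OF bounded_linear_ident]])

lemma L2_space_diff:
  fixes v w :: "'w \<Rightarrow> 'x::{real_normed_vector, second_countable_topology}"
  assumes "v \<in> L2_space P" "w \<in> L2_space P"
  shows "(\<lambda>\<omega>. v \<omega> - w \<omega>) \<in> L2_space P"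
  using L2_space_add[OF assms(1) L2_space_minus[OF assms(2)]] by simp

lemma L2_space_product_integrable:
  fixes h :: "'w \<Rightarrow> 'z::{banach, second_countable_topology}"
  assumes "v \<in> L2_space P" "w \<in> L2_space P" "h \<in> borel_measurable P"
    and "AE \<omega> in P. norm (h \<omega>) \<le> C * (norm (v \<omega>) * norm (w \<omega>))"
  shows "integrable P h"
proof (rule Bochner_Integration.integrable_bound)
  show "integrable P (\<lambda>\<omega>. \<bar>C\<bar> * ((norm (v \<omega>))\<^sup>2 + (norm (w \<omega>))\<^sup>2))"
    using assms(1,2)[THEN L2_spaceD(2)] by simp
  show "AE \<omega> in P. norm (h \<omega>) \<le> norm (\<bar>C\<bar> * ((norm (v \<omega>))\<^sup>2 + (norm (w \<omega>))\<^sup>2))"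
    using assms(4)
  proof eventually_elim
    case (elim \<omega>)
    have "norm (v \<omega>) * norm (w \<omega>) \<le> (norm (v \<omega>))\<^sup>2 + (norm (w \<omega>))\<^sup>2"
      using sum_squares_bound[of "norm (v \<omega>)" "norm (w \<omega>)"]
        mult_nonneg_nonneg[OF norm_ge_zero norm_ge_zero, of "v \<omega>" "w \<omega>"] by linarith
    then have "C * (norm (v \<omega>) * norm (w \<omega>)) \<le> \<bar>C\<bar> * ((norm (v \<omega>))\<^sup>2 + (norm (w \<omega>))\<^sup>2)"
      by (intro mult_mono) auto
    then show ?case using elim by (simp add: abs_mult)
  qed
qed fact

lemma L2_space_bilinear_integrable:
  fixes B :: "'x::{real_normed_vector, second_countable_topology} \<Rightarrow>
    'y::{real_normed_vector, second_countable_topology} \<Rightarrow> 'z::{banach, second_countable_topology}"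
  assumes B: "bounded_bilinear B" and v: "v \<in> L2_space P" and w: "w \<in> L2_space P"
  shows "integrable P (\<lambda>\<omega>. B (v \<omega>) (w \<omega>))"
proof -
  obtain K where K: "\<And>a b. norm (B a b) \<le> norm a * norm b * K"
    using bounded_bilinear.bounded[OF B] by blast
  show ?thesis
    using borel_measurable_bounded_bilinear[OF B L2_spaceD(1)[OF v] L2_spaceD(1)[OF w]]
    by (rule L2_space_product_integrable[OF v w, where C = K]) (simp add: K mult.commute[of K])
qed

lemma L2_space_const:
  assumes "finite_measure P" shows "(\<lambda>_. c) \<in> L2_space P"
proof -
  interpret finite_measure P by fact
  show ?thesis by (simp add: L2_space_def)
qed

text \<open>The constant 1 is square integrable on a finite measure space, and its product with
  \<open>v\<close> is \<open>v\<close>.\<close>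

lemma L2_space_integrable:
  fixes v :: "'w \<Rightarrow> 'x::{banach, second_countable_topology}"
  assumes "finite_measure P" "v \<in> L2_space P"
  shows "integrable P v"
  using L2_space_bilinear_integrable[OF bounded_bilinear_scaleR L2_space_const[OF assms(1), of 1] assms(2)]
  by simp

section \<open>Random operators acting on random vectors\<close>

lemma borel_measurable_blinfun_apply_simple:
  fixes K :: "'w \<Rightarrow> 'v::real_normed_vector \<Rightarrow>\<^sub>L 'x::real_normed_vector"
  assumes "K \<in> borel_measurable N"
  shows "(\<lambda>x. blinfun_apply (K x) v) \<in> borel_measurable N"
  by (rule measurable_compose[OF assms borel_measurable_continuous_onI])
    (intro continuous_intros)

text \<open>
  The space of operators need not be second countable, so joint continuity of application does not
  give measurability here; a Caratheodory argument does.
\<close>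
lemma borel_measurable_blinfun_apply:
  fixes K :: "'w \<Rightarrow> 'v::{real_normed_vector, second_countable_topology} \<Rightarrow>\<^sub>L 'x::real_normed_vector"
  assumes K: "K \<in> borel_measurable N" and v: "v \<in> borel_measurable N"
  shows "(\<lambda>x. blinfun_apply (K x) (v x)) \<in> borel_measurable N"
proof -
  obtain F where F: "\<And>i. simple_function N (F i)" "\<And>x. x \<in> space N \<Longrightarrow> (\<lambda>i. F i x) \<longlonglongrightarrow> v x"
    using borel_measurable_implies_sequence_metric[OF v, of 0] by blast
  show ?thesis
  proof (rule borel_measurable_LIMSEQ_metric)
    fix i
    \<comment> \<open>\<open>F i\<close> takes finitely many values, so the map is patched from
      countably many pieces on each of which the operator acts on a fixed vector.\<close>
    have "F i \<in> measurable N (count_space (F i ` space N))"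
      using simple_functionD[OF F(1)[of i]] by (simp add: measurable_count_space_eq2)
    then show "(\<lambda>x. blinfun_apply (K x) (F i x)) \<in> borel_measurable N"
      by (rule measurable_compose_countable'[where f = "\<lambda>v x. blinfun_apply (K x) v", rotated])
        (auto intro: borel_measurable_blinfun_apply_simple[OF K] countable_finite simple_functionD(1)[OF F(1)])
  next
    fix x assume "x \<in> space N"
    then show "(\<lambda>i. blinfun_apply (K x) (F i x)) \<longlonglongrightarrow> blinfun_apply (K x) (v x)"
      by (intro tendsto_intros F)
  qed
qed

lemma random_op_L2:
  fixes K :: "'w \<Rightarrow> 'v::{real_inner, second_countable_topology} \<Rightarrow>\<^sub>L ('v \<Rightarrow>\<^sub>L real)"
  assumes K: "K \<in> borel_measurable P"
    and bound: "\<And>\<omega> v. \<omega> \<in> space P \<Longrightarrow> norm (blinfun_apply (K \<omega>) v) \<le> C * norm v"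
    and v: "v \<in> L2_space P"
  shows "random_op K v \<in> L2_space P"
proof (rule L2_space_bound[OF v, where C = C])
  show "random_op K v \<in> borel_measurable P"
    unfolding random_op_def by (intro borel_measurable_blinfun_apply K L2_spaceD(1)[OF v])
  show "AE \<omega> in P. norm (random_op K v \<omega>) \<le> C * norm (v \<omega>)"
    by (rule AE_I2) (simp add: random_op_def bound)
qed

lemma energy_form_integrable:
  fixes K :: "'w \<Rightarrow> 'v::{real_inner, second_countable_topology} \<Rightarrow>\<^sub>L ('v \<Rightarrow>\<^sub>L real)"
  assumes K: "K \<in> borel_measurable P"
    and bound: "\<And>\<omega> v. \<omega> \<in> space P \<Longrightarrow> norm (blinfun_apply (K \<omega>) v) \<le> C * norm v"
    and v: "v \<in> L2_space P" and w: "w \<in> L2_space P"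
  shows "integrable P (\<lambda>\<omega>. blinfun_apply (random_op K v \<omega>) (w \<omega>))"
  by (intro L2_space_bilinear_integrable[OF bounded_bilinear_blinfun_apply] w
      random_op_L2[OF K bound v])

section \<open>Chain rule for quadratic forms along absolutely continuous paths\<close>

lemma time_derivative_L2D:
  assumes "time_derivative_L2 P T g dg"
  shows "(\<lambda>(t, \<omega>). dg t \<omega>) \<in> borel_measurable (time_interval T \<Otimes>\<^sub>M P)"
    "AE t in time_interval T. dg t \<in> L2_space P"
    "integrable (time_interval T) (\<lambda>t. L2_norm P (dg t))"
    "\<And>t. t \<in> {0..T} \<Longrightarrow> g t \<in> L2_space P"
    "\<And>t. t \<in> {0..T} \<Longrightarrow> AE \<omega> in P. g t \<omega> = g 0 \<omega> + primitive T (\<lambda>s. dg s \<omega>) t"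
  using assms by (auto simp: time_derivative_L2_def simp flip: primitive_eq)

lemma L2_timeD:
  fixes w :: "real \<Rightarrow> 'w \<Rightarrow> 'x::{real_normed_vector, second_countable_topology}"
  assumes "prob_space P" "w \<in> L2_time P T"
  shows "AE t in time_interval T. w t \<in> L2_space P"
    "integrable (time_interval T) (\<lambda>t. (L2_norm P (w t))\<^sup>2)"
    "(L2_time_norm P T w)\<^sup>2 = (\<integral>t. (L2_norm P (w t))\<^sup>2 \<partial>time_interval T)"
proof -
  let ?M = "time_interval T"
  interpret M: finite_measure ?M by (rule finite_measure_time_interval)
  interpret prob_space P by fact
  interpret MP: pair_sigma_finite ?M P ..
  have w: "(\<lambda>(t, \<omega>). w t \<omega>) \<in> L2_space (?M \<Otimes>\<^sub>M P)" using assms(2) by (simp add: L2_time_def)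
  have meas [measurable]: "(\<lambda>(t, \<omega>). w t \<omega>) \<in> borel_measurable (?M \<Otimes>\<^sub>M P)"
    by (rule L2_spaceD(1)[OF w])
  have "(\<lambda>x. (norm (case x of (t, \<omega>) \<Rightarrow> w t \<omega>))\<^sup>2) = (\<lambda>(t, \<omega>). (norm (w t \<omega>))\<^sup>2)"
    by (auto simp: split_beta')
  then have int: "integrable (?M \<Otimes>\<^sub>M P) (\<lambda>(t, \<omega>). (norm (w t \<omega>))\<^sup>2)"
    using L2_spaceD(2)[OF w] by simp
  show "AE t in ?M. w t \<in> L2_space P"
    using MP.AE_integrable_fst[OF int] AE_space
  proof eventually_elim
    case (elim t)
    then show ?case using measurable_compose[OF measurable_Pair1'[of t ?M P] meas]
      by (simp add: L2_space_def)
  qed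
  have sq: "(L2_norm P (w t))\<^sup>2 = (\<integral>\<omega>. (norm (w t \<omega>))\<^sup>2 \<partial>P)" for t
    by (simp add: L2_norm_def)
  show "integrable ?M (\<lambda>t. (L2_norm P (w t))\<^sup>2)"
    unfolding sq by (rule MP.integrable_fst[OF int])
  show "(L2_time_norm P T w)\<^sup>2 = (\<integral>t. (L2_norm P (w t))\<^sup>2 \<partial>?M)"
    unfolding L2_time_norm_def set_integral_time_interval_full by simp
qed

text \<open>For fixed \<omega> the operator \<open>K \<omega>\<close> is a bounded bilinear form on
  V, so the product rule applies path by path; integrating over \<omega> and exchanging the
  integrals gives the claim. The bound \<open>C\<close> is uniform in \<omega>, which yields the
  joint integrability required by Fubini.\<close>

lemma energy_form_derivative:
  fixes K :: "'w \<Rightarrow> 'v::{real_inner, banach, second_countable_topology} \<Rightarrow>\<^sub>L ('v \<Rightarrow>\<^sub>L real)"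
  assumes "prob_space P"
    and K: "K \<in> borel_measurable P"
    and bound: "\<And>\<omega> v. \<omega> \<in> space P \<Longrightarrow> norm (blinfun_apply (K \<omega>) v) \<le> C * norm v"
    and u: "u \<in> L2_time P T" and du: "du \<in> L2_time P T"
    and deriv: "time_derivative_L2 P T u du"
  defines "k \<equiv> \<lambda>s. energy_form P K (du s) (u s) + energy_form P K (u s) (du s)"
  shows "integrable (time_interval T) k"
    and "\<And>t. t \<in> {0..T} \<Longrightarrow> energy_form P K (u t) (u t) = energy_form P K (u 0) (u 0) + primitive T k t"
proof -
  let ?M = "time_interval T"
  interpret M: finite_measure ?M by (rule finite_measure_time_interval)
  interpret prob_space P by fact
  interpret MP: pair_sigma_finite ?M P ..
  interpret MPf: finite_measure "?M \<Otimes>\<^sub>M P"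
    by (intro finite_measure_pair_measure finite_measure_time_interval finite_measure_axioms)
  note D = time_derivative_L2D[OF deriv]
  \<comment> \<open>The path of \<open>u\<close> rebuilt from its derivative: absolutely continuous
    in t for almost every \<omega>, and equal to \<open>u t\<close> almost surely at each single
    time t.\<close>
  define ut where "ut = (\<lambda>\<omega> t. u 0 \<omega> + primitive T (\<lambda>s. du s \<omega>) t)"
  define kt where "kt = (\<lambda>\<omega> s. K \<omega> (du s \<omega>) (ut \<omega> s) + K \<omega> (ut \<omega> s) (du s \<omega>))"
  have u_joint: "(\<lambda>(t, \<omega>). u t \<omega>) \<in> L2_space (?M \<Otimes>\<^sub>M P)"
    and du_joint: "(\<lambda>(t, \<omega>). du t \<omega>) \<in> L2_space (?M \<Otimes>\<^sub>M P)"
    using u du by (auto simp: L2_time_def)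
  note [measurable] = L2_spaceD(1)[OF u_joint] L2_spaceD(1)[OF du_joint]
  have ut_eq: "AE \<omega> in P. u t \<omega> = ut \<omega> t" if "t \<in> {0..T}" for t
    using D(5)[OF that] by (simp add: ut_def)

  \<comment> \<open>Joint square integrability is given for \<open>u\<close>, not for
    \<open>ut\<close>; the resulting integrability passes over because the two agree almost
    everywhere on the product. The condition on T places 0 in the interval, where \<open>u 0\<close>
    is known to be measurable.\<close>
  have kt_int: "integrable (?M \<Otimes>\<^sub>M P) (\<lambda>(s, \<omega>). kt \<omega> s)" if T0: "0 \<le> T"
  proof -
    have [measurable]: "u 0 \<in> borel_measurable P" using L2_spaceD(1)[OF D(4)[of 0]] T0 by simp
    have [measurable]: "(\<lambda>(s, \<omega>). ut \<omega> s) \<in> borel_measurable (?M \<Otimes>\<^sub>M P)"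
      unfolding ut_def using measurable_primitive[of "\<lambda>\<omega> s. du s \<omega>" T P] by (simp add: split_beta')
    have ae: "AE x in ?M \<Otimes>\<^sub>M P. (\<lambda>(s, \<omega>). u s \<omega>) x = (\<lambda>(s, \<omega>). ut \<omega> s) x"
    proof (rule MP.AE_pair_measure)
      show "AE s in ?M. AE \<omega> in P. (\<lambda>(s, \<omega>). u s \<omega>) (s, \<omega>) = (\<lambda>(s, \<omega>). ut \<omega> s) (s, \<omega>)"
        by (rule AE_I2) (use ut_eq in auto)
    qed measurable
    have KK: "(\<lambda>x. K (snd x)) \<in> borel_measurable (?M \<Otimes>\<^sub>M P)" using K by measurable
    have b: "norm (blinfun_apply (K (snd x)) v) \<le> C * norm v" if "x \<in> space (?M \<Otimes>\<^sub>M P)" for x v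
      using that bound by (auto simp: space_pair_measure)
    have "integrable (?M \<Otimes>\<^sub>M P)
      (\<lambda>x. blinfun_apply (random_op (\<lambda>x. K (snd x)) (\<lambda>(t, \<omega>). du t \<omega>) x) ((\<lambda>(t, \<omega>). u t \<omega>) x)
         + blinfun_apply (random_op (\<lambda>x. K (snd x)) (\<lambda>(t, \<omega>). u t \<omega>) x) ((\<lambda>(t, \<omega>). du t \<omega>) x))"
      by (intro Bochner_Integration.integrable_add energy_form_integrable[OF KK b] u_joint du_joint) 
    moreover have "(\<lambda>(s, \<omega>). kt \<omega> s) \<in> borel_measurable (?M \<Otimes>\<^sub>M P)"
      unfolding kt_def split_beta'
      by (intro borel_measurable_add borel_measurable_bounded_bilinear[OF bounded_bilinear_blinfun_apply]
          borel_measurable_blinfun_apply[OF KK]) measurable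
    moreover have "AE x in ?M \<Otimes>\<^sub>M P. 
        blinfun_apply (random_op (\<lambda>x. K (snd x)) (\<lambda>(t, \<omega>). du t \<omega>) x) ((\<lambda>(t, \<omega>). u t \<omega>) x)
         + blinfun_apply (random_op (\<lambda>x. K (snd x)) (\<lambda>(t, \<omega>). u t \<omega>) x) ((\<lambda>(t, \<omega>). du t \<omega>) x)
        = (\<lambda>(s, \<omega>). kt \<omega> s) x"
      using ae by eventually_elim (auto simp: kt_def random_op_def)
    ultimately show ?thesis
      by (subst integrable_cong_AE[symmetric]) (auto dest: borel_measurable_integrable)
  qed

  have k_eq: "AE s in ?M. k s = (\<integral>\<omega>. kt \<omega> s \<partial>P)"
    using D(2) AE_space
  proof eventually_elim
    case (elim s)
    then have s: "s \<in> {0..T}" by simp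
    note us = D(4)[OF s]
    have "0 \<le> T" using s by auto
    have "k s = (\<integral>\<omega>. K \<omega> (du s \<omega>) (u s \<omega>) + K \<omega> (u s \<omega>) (du s \<omega>) \<partial>P)"
      using energy_form_integrable[OF K bound elim(1) us] energy_form_integrable[OF K bound us elim(1)]
      by (simp add: k_def energy_form_def random_op_def)
    also have "\<dots> = (\<integral>\<omega>. kt \<omega> s \<partial>P)"
    proof (rule integral_cong_AE)
      show "(\<lambda>\<omega>. K \<omega> (du s \<omega>) (u s \<omega>) + K \<omega> (u s \<omega>) (du s \<omega>)) \<in> borel_measurable P"
        using energy_form_integrable[OF K bound elim(1) us] energy_form_integrable[OF K bound us elim(1)]
        by (auto simp: random_op_def)
      show "(\<lambda>\<omega>. kt \<omega> s) \<in> borel_measurable P"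
        using measurable_compose[OF measurable_Pair1'[of s ?M P] borel_measurable_integrable[OF kt_int]]
          elim(2) \<open>0 \<le> T\<close> by simp
      show "AE \<omega> in P. K \<omega> (du s \<omega>) (u s \<omega>) + K \<omega> (u s \<omega>) (du s \<omega>) = kt \<omega> s"
        using ut_eq[OF s] by eventually_elim (simp add: kt_def)
    qed
    finally show ?case .
  qed
  have k_meas: "k \<in> borel_measurable ?M"
  proof -
    have KK: "(\<lambda>x. K (snd x)) \<in> borel_measurable (?M \<Otimes>\<^sub>M P)" using K by measurable
    have "(\<lambda>(s, \<omega>). K \<omega> (du s \<omega>) (u s \<omega>)) \<in> borel_measurable (?M \<Otimes>\<^sub>M P)"
      "(\<lambda>(s, \<omega>). K \<omega> (u s \<omega>) (du s \<omega>)) \<in> borel_measurable (?M \<Otimes>\<^sub>M P)"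
      unfolding split_beta'
      by (intro borel_measurable_bounded_bilinear[OF bounded_bilinear_blinfun_apply]
          borel_measurable_blinfun_apply[OF KK]; measurable)+
    then show ?thesis
      unfolding k_def energy_form_def random_op_def
      by (intro borel_measurable_add borel_measurable_lebesgue_integral)
  qed
  show k_int: "integrable ?M k"
  proof (cases "0 \<le> T")
    case True
    have "integrable ?M (\<lambda>s. \<integral>\<omega>. kt \<omega> s \<partial>P)"
      using MP.integrable_fst[OF kt_int[OF True]] by simp
    then show ?thesis
      using k_eq k_meas by (subst integrable_cong_AE[where g = "\<lambda>s. \<integral>\<omega>. kt \<omega> s \<partial>P"]) auto
  next
    case False
    then have "space ?M = {}" by simp
    then have "integrable ?M k \<longleftrightarrow> integrable ?M (\<lambda>_. 0 :: real)"
      by (intro Bochner_Integration.integrable_cong) auto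
    then show ?thesis by simp
  qed

  fix t assume t: "t \<in> {0..T}"
  then have T0: "0 \<le> T" "0 \<in> {0..T}" by auto
  note kt = kt_int[OF T0(1)]
  have kt_t: "integrable (?M \<Otimes>\<^sub>M P) (\<lambda>(s, \<omega>). indicator {0..t} s *\<^sub>R kt \<omega> s)"
  proof -
    have "{0..t} \<inter> {0..T} \<in> sets ?M" by (rule Icc_inter_sets_time_interval)
    moreover have "{0..t} \<inter> {0..T} = {0..t}" using t by auto
    ultimately have "{0..t} \<times> space P \<in> sets (?M \<Otimes>\<^sub>M P)" by (auto simp del: Int_atLeastAtMost)
    from integrable_mult_indicator[OF this kt] show ?thesis
      by (rule Bochner_Integration.integrable_cong[THEN iffD1, rotated -1])
        (auto simp: space_pair_measure indicator_def)
  qed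
  have swap: "(\<integral>\<omega>. primitive T (kt \<omega>) t \<partial>P) = primitive T k t"
  proof -
    have "(\<integral>\<omega>. primitive T (kt \<omega>) t \<partial>P) = (\<integral>s. \<integral>\<omega>. indicator {0..t} s *\<^sub>R kt \<omega> s \<partial>P \<partial>?M)"
      unfolding primitive_def set_lebesgue_integral_def
      by (rule MP.Fubini_integral[where f = "\<lambda>s \<omega>. indicator {0..t} s *\<^sub>R kt \<omega> s"]) (rule kt_t)
    also have "\<dots> = (\<integral>s. indicator {0..t} s *\<^sub>R (\<integral>\<omega>. kt \<omega> s \<partial>P) \<partial>?M)" by simp
    also have "\<dots> = primitive T (\<lambda>s. \<integral>\<omega>. kt \<omega> s \<partial>P) t"
      by (simp add: primitive_def set_lebesgue_integral_def)
    also have "\<dots> = primitive T k t"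
      by (rule primitive_cong_AE)
        (use k_eq k_meas borel_measurable_integrable[OF MP.integrable_fst[OF kt]] in auto)
    finally show ?thesis .
  qed
  have du_int: "AE \<omega> in P. integrable ?M (\<lambda>s. du s \<omega>)"
    by (rule MP.AE_integrable_snd)
      (rule L2_space_integrable[OF MPf.finite_measure_axioms du_joint])
  have pointwise: "AE \<omega> in P. K \<omega> (u t \<omega>) (u t \<omega>) = K \<omega> (u 0 \<omega>) (u 0 \<omega>) + primitive T (kt \<omega>) t"
    using du_int ut_eq[OF t]
  proof eventually_elim
    case (elim \<omega>)
    have B: "bounded_bilinear (\<lambda>v w. blinfun_apply (blinfun_apply (K \<omega>) v) w)"
      by (rule bounded_bilinear.comp1[OF bounded_bilinear_blinfun_apply blinfun.bounded_linear_right])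
    have "K \<omega> (ut \<omega> t) (ut \<omega> t) = K \<omega> (u 0 \<omega>) (u 0 \<omega>) + primitive T (kt \<omega>) t"
      unfolding kt_def
      by (rule primitive_product_affine(2)[OF B elim(1) elim(1)]) (simp_all add: ut_def)
    then show ?case using elim by simp
  qed
  have int0: "integrable P (\<lambda>\<omega>. K \<omega> (u r \<omega>) (u r \<omega>))" if "r \<in> {0..T}" for r
    using energy_form_integrable[OF K bound D(4)[OF that] D(4)[OF that]] by (simp add: random_op_def)
  have prim_int: "integrable P (\<lambda>\<omega>. primitive T (kt \<omega>) t)"
    unfolding primitive_def set_lebesgue_integral_def by (rule MP.integrable_snd[OF kt_t])
  have "energy_form P K (u t) (u t) = (\<integral>\<omega>. K \<omega> (u 0 \<omega>) (u 0 \<omega>) + primitive T (kt \<omega>) t \<partial>P)"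
    unfolding energy_form_def random_op_def
    by (rule integral_cong_AE)
      (use int0[OF t] int0[OF T0(2)] prim_int pointwise in auto)
  also have "\<dots> = energy_form P K (u 0) (u 0) + primitive T k t"
    by (simp add: int0[OF T0(2)] prim_int swap energy_form_def random_op_def)
  finally show "energy_form P K (u t) (u t) = energy_form P K (u 0) (u 0) + primitive T k t" .
qed

section \<open>The derivative of a low-rank function\<close>

text \<open>Jensen's inequality for the square, read off from the non-negative variance of the
  norm.\<close>

lemma (in prob_space) expectation_norm_le_L2_norm:
  fixes v :: "'a \<Rightarrow> 'x::{banach, second_countable_topology}"
  assumes "v \<in> L2_space M"
  shows "(\<integral>\<omega>. norm (v \<omega>) \<partial>M) \<le> L2_norm M v"
proof -
  have "integrable M (\<lambda>\<omega>. norm (v \<omega>))"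
    using L2_space_integrable[OF finite_measure_axioms assms] by simp
  then have "variance (\<lambda>\<omega>. norm (v \<omega>)) = expectation (\<lambda>\<omega>. (norm (v \<omega>))\<^sup>2) - (expectation (\<lambda>\<omega>. norm (v \<omega>)))\<^sup>2"
    using L2_spaceD(2)[OF assms] by (intro variance_eq)
  then have "(expectation (\<lambda>\<omega>. norm (v \<omega>)))\<^sup>2 \<le> expectation (\<lambda>\<omega>. (norm (v \<omega>))\<^sup>2)"
    using variance_positive[of "\<lambda>\<omega>. norm (v \<omega>)"] by linarith
  then show ?thesis unfolding L2_norm_def by (rule real_le_rsqrt)
qed

text \<open>The L2 norm over \<omega> is integrable in time, though perhaps not square integrable,
  as for the Y'_i. On a probability space it dominates the L1 norm, and joint integrability follows;
  this makes almost every path integrable.\<close>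

lemma time_derivative_L2_integrable:
  fixes g dg :: "real \<Rightarrow> 'w \<Rightarrow> 'x::{banach, second_countable_topology}"
  assumes "prob_space P" and deriv: "time_derivative_L2 P T g dg"
  shows "integrable (time_interval T \<Otimes>\<^sub>M P) (\<lambda>(t, \<omega>). dg t \<omega>)"
proof -
  let ?M = "time_interval T"
  interpret M: finite_measure ?M by (rule finite_measure_time_interval)
  interpret prob_space P by fact
  interpret MP: pair_sigma_finite ?M P ..
  note D = time_derivative_L2D[OF deriv]
  note [measurable] = D(1)
  show ?thesis
  proof (rule MP.Fubini_integrable)
    show "AE t in ?M. integrable P (\<lambda>\<omega>. (\<lambda>(t, \<omega>). dg t \<omega>) (t, \<omega>))"
      using D(2) by eventually_elim (simp add: L2_space_integrable[OF finite_measure_axioms])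
    show "integrable ?M (\<lambda>t. \<integral>\<omega>. norm ((\<lambda>(t, \<omega>). dg t \<omega>) (t, \<omega>)) \<partial>P)"
    proof (rule Bochner_Integration.integrable_bound[OF D(3)])
      show "(\<lambda>t. \<integral>\<omega>. norm ((\<lambda>(t, \<omega>). dg t \<omega>) (t, \<omega>)) \<partial>P) \<in> borel_measurable ?M"
        by measurable
      show "AE t in ?M. norm (\<integral>\<omega>. norm ((\<lambda>(t, \<omega>). dg t \<omega>) (t, \<omega>)) \<partial>P) \<le> norm (L2_norm P (dg t))"
        using D(2) by eventually_elim (use expectation_norm_le_L2_norm in fastforce)
    qed
  qed measurable
qed

lemma time_derivativeD:
  assumes "time_derivative T g dg" "t \<in> {0..T}"
  shows "g t = g 0 + primitive T dg t"
  using bspec[OF conjunct2[OF assms(1)[unfolded time_derivative_def]] assms(2)] assms(2)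
  by (subst primitive_eq[symmetric]) simp_all

text \<open>
  Integrated in time, the two sides agree almost surely for every \<open>t\<close>; continuity in \<open>t\<close> makes
  the exceptional set independent of \<open>t\<close>.
\<close>
lemma low_rank_derivative:
  fixes J :: "'v::{banach, second_countable_topology} \<Rightarrow> 'x::{banach, second_countable_topology}"
    and u du :: "real \<Rightarrow> 'w \<Rightarrow> 'v" and Y dY :: "'r::finite \<Rightarrow> real \<Rightarrow> 'w \<Rightarrow> real"
  assumes "prob_space P" and J: "bounded_linear J"
    and deriv: "time_derivative_L2 P T u du"
    and Y: "\<And>i. time_derivative_L2 P T (Y i) (dY i)"
    and A: "time_derivative T A dA" and B: "\<And>i. time_derivative T (B i) (dB i)"
    and repr: "\<And>t. t \<in> {0..T} \<Longrightarrow> AE \<omega> in P. J (u t \<omega>) = A t + (\<Sum>i\<in>UNIV. Y i t \<omega> *\<^sub>R B i t)"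
  shows "AE t in time_interval T. AE \<omega> in P.
    J (du t \<omega>) = dA t + (\<Sum>i\<in>UNIV. dY i t \<omega> *\<^sub>R B i t + Y i t \<omega> *\<^sub>R dB i t)"
proof (cases "0 \<le> T")
  case False
  then have "AE t in time_interval T. False" by (intro AE_I2) simp
  then show ?thesis by (rule eventually_mono) simp
next
  case True
  let ?M = "time_interval T"
  interpret M: finite_measure ?M by (rule finite_measure_time_interval)
  interpret prob_space P by fact
  interpret MP: pair_sigma_finite ?M P ..
  interpret J: bounded_linear J by fact
  note Du = time_derivative_L2D[OF deriv] and DY = time_derivative_L2D[OF Y]
  have 0: "0 \<in> {0..T}" using True by simp
  have dA: "integrable ?M dA" and dB: "\<And>i. integrable ?M (dB i)"
    using A B by (auto simp: time_derivative_def)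
  have A_eq: "A t = A 0 + primitive T dA t" and B_eq: "B i t = B i 0 + primitive T (dB i) t"
    if "t \<in> {0..T}" for t i
    by (rule time_derivativeD[OF A that] time_derivativeD[OF B that])+
  \<comment> \<open>\<open>Bt\<close> and \<open>Yt\<close> are primitives with the initial values
    of \<open>B\<close> and \<open>Y\<close>: on [0,T] \<open>Bt\<close> equals \<open>B\<close>,
    and \<open>Yt\<close> equals \<open>Y\<close> almost surely at each t.\<close>
  define Bt where "Bt = (\<lambda>i t. B i 0 + primitive T (dB i) t)"
  define Yt where "Yt = (\<lambda>i \<omega> t. Y i 0 \<omega> + primitive T (\<lambda>s. dY i s \<omega>) t)"
  define s where "s = (\<lambda>i \<omega> t. dY i t \<omega> *\<^sub>R Bt i t + Yt i \<omega> t *\<^sub>R dB i t)"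
  \<comment> \<open>The defect of the asserted identity, written with these representatives so that
    its primitive can be computed for a fixed \<omega>.\<close>
  define h where "h = (\<lambda>\<omega> t. J (du t \<omega>) - (dA t + (\<Sum>i\<in>UNIV. s i \<omega> t)))"
  have du_int: "AE \<omega> in P. integrable ?M (\<lambda>t. du t \<omega>)"
    by (rule MP.AE_integrable_snd[OF time_derivative_L2_integrable[OF assms(1) deriv]])
  have dY_int: "AE \<omega> in P. \<forall>i. integrable ?M (\<lambda>t. dY i t \<omega>)"
    using MP.AE_integrable_snd[OF time_derivative_L2_integrable[OF assms(1) Y]]
    by (subst AE_all_countable) auto
  have h_int: "integrable ?M (h \<omega>)"
    and h_prim: "primitive T (h \<omega>) t = J (primitive T (\<lambda>t. du t \<omega>) t)
      - (primitive T dA t + (\<Sum>i\<in>UNIV. Yt i \<omega> t *\<^sub>R Bt i t - Y i 0 \<omega> *\<^sub>R B i 0))"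
    if 1: "integrable ?M (\<lambda>t. du t \<omega>)" and 2: "\<forall>i. integrable ?M (\<lambda>t. dY i t \<omega>)" for \<omega> t
  proof -
    have s_int: "integrable ?M (s i \<omega>)" for i
      unfolding s_def
      by (rule primitive_product_affine(1)[OF bounded_bilinear_scaleR 2[rule_format] dB])
        (auto simp: Yt_def Bt_def)
    have s_prim: "Yt i \<omega> t *\<^sub>R Bt i t = Y i 0 \<omega> *\<^sub>R B i 0 + primitive T (s i \<omega>) t" for i
      unfolding s_def
      by (rule primitive_product_affine(2)[OF bounded_bilinear_scaleR 2[rule_format] dB])
        (auto simp: Yt_def Bt_def)
    note J_int = integrable_bounded_linear[OF J 1]
    have sum_int: "integrable ?M (\<lambda>t. dA t + (\<Sum>i\<in>UNIV. s i \<omega> t))"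
      using dA s_int by simp
    show "integrable ?M (h \<omega>)" unfolding h_def using J_int sum_int by simp
    have "primitive T (h \<omega>) t = J (primitive T (\<lambda>t. du t \<omega>) t)
        - (primitive T dA t + (\<Sum>i\<in>UNIV. primitive T (s i \<omega>) t))"
      unfolding h_def
      by (simp add: primitive_diff[OF J_int sum_int] primitive_add[OF dA] primitive_sum s_int
          primitive_bounded_linear[OF J 1])
    then show "primitive T (h \<omega>) t = J (primitive T (\<lambda>t. du t \<omega>) t)
      - (primitive T dA t + (\<Sum>i\<in>UNIV. Yt i \<omega> t *\<^sub>R Bt i t - Y i 0 \<omega> *\<^sub>R B i 0))"
      by (simp add: s_prim)
  qed
  have Yt_eq: "AE \<omega> in P. \<forall>i. Y i t \<omega> = Yt i \<omega> t" if "t \<in> {0..T}" for t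
    unfolding AE_all_countable using DY(5)[OF that] by (auto simp: Yt_def)
  have zero: "AE \<omega> in P. primitive T (h \<omega>) t = 0" if t: "t \<in> {0..T}" for t
    using du_int dY_int Yt_eq[OF t] Du(5)[OF t] repr[OF t] repr[OF 0]
  proof eventually_elim
    case (elim \<omega>)
    have "J (primitive T (\<lambda>t. du t \<omega>) t) = J (u t \<omega>) - J (u 0 \<omega>)"
      using elim(4) by (simp add: J.add)
    also have "\<dots> = primitive T dA t + (\<Sum>i\<in>UNIV. Y i t \<omega> *\<^sub>R B i t - Y i 0 \<omega> *\<^sub>R B i 0)"
      by (simp only: elim(5,6) A_eq[OF t]) (simp add: sum_subtractf)
    also have "(\<Sum>i\<in>UNIV. Y i t \<omega> *\<^sub>R B i t - Y i 0 \<omega> *\<^sub>R B i 0)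
        = (\<Sum>i\<in>UNIV. Yt i \<omega> t *\<^sub>R Bt i t - Y i 0 \<omega> *\<^sub>R B i 0)"
      using elim(3) B_eq[OF t] by (simp add: Bt_def)
    finally show ?case using h_prim[OF elim(1,2), of t] by simp
  qed
  \<comment> \<open>Outside [0,T] the primitive is 0 or equals its value at T, so every rational
    time is covered before the countable intersection of null sets is taken.\<close>
  have zero_all: "AE \<omega> in P. primitive T (h \<omega>) q = 0" for q
  proof -
    consider "q < 0" | "q \<in> {0..T}" | "T \<le> q" by force
    then show ?thesis
    proof cases
      case 1 then show ?thesis by (simp add: primitive_negative)
    next
      case 2 then show ?thesis by (rule zero)
    next
      case 3 then show ?thesis using zero[of T] True by (simp add: primitive_beyond[OF 3])
    qed
  qed
  have "AE \<omega> in P. \<forall>q\<in>\<rat>. primitive T (h \<omega>) q = 0"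
    using zero_all by (subst AE_ball_countable) (auto simp: countable_rat)
  then have ae: "AE \<omega> in P. AE t in ?M. h \<omega> t = 0"
    using du_int dY_int
    by eventually_elim (intro AE_zero_of_primitive_zero h_int; blast)
  \<comment> \<open>The exchange requires the zero set of \<open>h\<close> to be measurable in the
    product. \<open>Y\<close> is only known to be measurable at each fixed time, whereas
    \<open>Yt\<close> is jointly measurable.\<close>
  have "AE t in ?M. AE \<omega> in P. h \<omega> t = 0"
  proof (subst MP.AE_commute)
    note [measurable] = Du(1) DY(1) borel_measurable_integrable[OF dA] borel_measurable_integrable[OF dB]
    have [measurable]: "Y i 0 \<in> borel_measurable P" for i using L2_spaceD(1)[OF DY(4)[OF 0]] .
    have [measurable]: "(\<lambda>(t, \<omega>). Yt i \<omega> t) \<in> borel_measurable (?M \<Otimes>\<^sub>M P)" for i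
      unfolding Yt_def using measurable_primitive[of "\<lambda>\<omega> s. dY i s \<omega>" T P] DY(1) by (simp add: split_beta')
    have [measurable]: "Bt i \<in> borel_measurable ?M" for i
      unfolding Bt_def using primitive_measurable[of "dB i" T] by simp
    have [measurable]: "J \<in> borel_measurable borel"
      by (intro borel_measurable_continuous_onI J.continuous_on continuous_on_id)
    have "(\<lambda>x. h (snd x) (fst x)) \<in> borel_measurable (?M \<Otimes>\<^sub>M P)"
      unfolding h_def s_def by measurable
    then show "{x \<in> space (?M \<Otimes>\<^sub>M P). h (snd x) (fst x) = 0} \<in> sets (?M \<Otimes>\<^sub>M P)"
      by measurable
  qed (rule ae)
  then show ?thesis
    using AE_space
  proof eventually_elim
    case (elim t)
    then have t: "t \<in> {0..T}" by simp
    show ?case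
      using elim(1) Yt_eq[OF t]
      by eventually_elim (simp add: h_def s_def Bt_def flip: B_eq[OF t])
  qed
qed

section \<open>Orthogonality of the residual\<close>

lemma bounded_linear_H_to_dual: "bounded_linear (H_to_dual E)"
  unfolding H_to_dual_def[abs_def]
  by (rule bounded_linear_compose[OF bounded_bilinear.bounded_linear_left[OF bounded_bilinear_blinfun_compose]
        bounded_linear_blinfun_inner_right])

text \<open>The H inner product pulled back to V along E, packaged as an operator from V to V' so
  that it can stand in the place of \<open>L\<close> in \<open>energy_form\<close>. It is also the
  embedding of V into V' through which the derivatives of mean and modes are read.\<close>

definition H_form :: "('v::real_inner \<Rightarrow>\<^sub>L 'h::real_inner) \<Rightarrow> 'v \<Rightarrow>\<^sub>L ('v \<Rightarrow>\<^sub>L real)" where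
  "H_form E = Blinfun (\<lambda>v. H_to_dual E (blinfun_apply E v))"

lemma H_form_apply: "blinfun_apply (H_form E) v = H_to_dual E (blinfun_apply E v)"
  unfolding H_form_def
  by (subst bounded_linear_Blinfun_apply)
    (auto intro: bounded_linear_compose[OF bounded_linear_H_to_dual blinfun.bounded_linear_right])

lemma H_to_dual_apply: "blinfun_apply (H_to_dual E h) v = inner h (blinfun_apply E v)"
  by (simp add: H_to_dual_def)

lemma H_form_apply_apply:
  "blinfun_apply (blinfun_apply (H_form E) v) w = inner (blinfun_apply E v) (blinfun_apply E w)"
  by (simp add: H_form_apply H_to_dual_apply)

text \<open>Evaluating the functional at v itself gives the squared H norm of E v. This lets an
  identity proved in V' descend to V.\<close>

lemma H_form_eq_0_iff:
  assumes "inj (blinfun_apply E)"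
  shows "blinfun_apply (H_form E) v = 0 \<longleftrightarrow> v = 0"
proof
  assume "blinfun_apply (H_form E) v = 0"
  then have "blinfun_apply (blinfun_apply (H_form E) v) v = 0" by simp
  then have "blinfun_apply E v = blinfun_apply E 0"
    unfolding H_form_apply_apply by (simp add: blinfun.zero_right)
  then show "v = 0" by (rule injD[OF assms])
qed (simp add: blinfun.zero_right)

text \<open>The quadratic form of the Gram matrix at x is the squared H norm of the combination of
  the E (U i) with coefficients x, so its kernel is trivial when E is injective and the U i are
  independent.\<close>

lemma invertible_gram:
  fixes U :: "'r::finite \<Rightarrow> 'v::real_inner"
  assumes E: "inj (blinfun_apply E)" and U: "inj U" "independent (range U)"
  shows "invertible (gram E U)"
proof -
  have "x = 0" if x: "gram E U *v x = 0" for x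
  proof -
    define w where "w = (\<Sum>i\<in>UNIV. (x $ i) *\<^sub>R U i)"
    have "inner (blinfun_apply E w) (blinfun_apply E w) = inner x (gram E U *v x)"
      unfolding w_def
      by (simp add: blinfun.sum_right blinfun.scaleR_right inner_sum_left inner_sum_right inner_vec_def
          matrix_vector_mult_def gram_def sum_distrib_left mult_ac)
        (intro sum.cong refl, simp add: inner_commute)
    then have "blinfun_apply E w = blinfun_apply E 0" using x by (simp add: blinfun.zero_right)
    then have w: "w = 0" by (rule injD[OF E])
    \<comment> \<open>\<open>independent\<close> speaks of a set, so the sum over indices is carried
      to \<open>range U\<close>; injectivity of \<open>U\<close> keeps the coefficients
      apart.\<close>
    have "(\<Sum>v\<in>range U. (x $ inv U v) *\<^sub>R v) = 0"
      using w U(1) by (simp add: w_def sum.reindex)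
    then have "x $ inv U (U i) = 0" for i
      by (intro independentD[OF U(2), of "range U" "\<lambda>v. x $ inv U v"]) auto
    then show "x = 0" using U(1) by (simp add: vec_eq_iff)
  qed
  then show ?thesis
    using matrix_left_invertible_ker[of "gram E U"] by (simp add: invertible_left_inverse)
qed

lemma matrix_mul_matrix_inv:
  fixes A :: "real^'n^'n"
  assumes "invertible A" shows "A ** matrix_inv A = mat 1"
  using assms unfolding invertible_def matrix_inv_def by (metis (mono_tags, lifting) someI_ex)

text \<open>\<open>r0\<close> removes the deterministic part of w, \<open>ry\<close> the parts y_i
  A_i for arbitrary vectors A_i, and \<open>rz\<close> the parts z_i U_i, where the directions U_i
  are fixed. These three kinds of parts span the tangent space at a low-rank function.\<close>

lemma expectation_pairing_zero:
  fixes r :: "'w \<Rightarrow> 'v::{real_inner, banach, second_countable_topology} \<Rightarrow>\<^sub>L real"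
    and y z :: "'r::finite \<Rightarrow> 'w \<Rightarrow> real"
  assumes "prob_space P" and r: "r \<in> L2_space P" and w: "w \<in> L2_space P"
    and y: "\<And>i. y i \<in> L2_space P" and z: "\<And>i. z i \<in> L2_space P"
    and r0: "(\<integral>\<omega>. r \<omega> \<partial>P) = 0"
    and ry: "\<And>j. (\<integral>\<omega>. y j \<omega> *\<^sub>R r \<omega> \<partial>P) = 0"
    and rz: "\<And>i. (\<integral>\<omega>. z i \<omega> * r \<omega> (U i) \<partial>P) = 0"
    and repr: "AE \<omega> in P. w \<omega> = a + (\<Sum>i\<in>UNIV. z i \<omega> *\<^sub>R U i + y i \<omega> *\<^sub>R A i)"
  shows "(\<integral>\<omega>. blinfun_apply (r \<omega>) (w \<omega>) \<partial>P) = 0"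
proof -
  interpret prob_space P by fact
  note r_int = L2_space_integrable[OF finite_measure_axioms r]
  have apply_int: "integrable P (\<lambda>\<omega>. blinfun_apply (g \<omega>) v)"
    and apply_integral: "(\<integral>\<omega>. blinfun_apply (g \<omega>) v \<partial>P) = blinfun_apply (\<integral>\<omega>. g \<omega> \<partial>P) v"
    if "integrable P g" for g :: "'w \<Rightarrow> 'v \<Rightarrow>\<^sub>L real" and v
    using integrable_bounded_linear[OF blinfun.bounded_linear_left that]
      integral_bounded_linear[OF blinfun.bounded_linear_left that] by auto
  have yr: "integrable P (\<lambda>\<omega>. y i \<omega> *\<^sub>R r \<omega>)" for i
    by (rule L2_space_bilinear_integrable[OF bounded_bilinear_scaleR y r])
  have zr: "integrable P (\<lambda>\<omega>. z i \<omega> * r \<omega> v)" for i v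
    by (intro L2_space_bilinear_integrable[OF bounded_bilinear_mult] z
        L2_space_bounded_linear[OF blinfun.bounded_linear_left] r)
  have yr': "integrable P (\<lambda>\<omega>. y i \<omega> * r \<omega> v)" for i v
    using apply_int[OF yr] by (simp add: blinfun.scaleR_left)
  have "(\<integral>\<omega>. blinfun_apply (r \<omega>) (w \<omega>) \<partial>P)
      = (\<integral>\<omega>. r \<omega> a + (\<Sum>i\<in>UNIV. z i \<omega> * r \<omega> (U i) + y i \<omega> * r \<omega> (A i)) \<partial>P)"
  proof (rule integral_cong_AE)
    show "(\<lambda>\<omega>. blinfun_apply (r \<omega>) (w \<omega>)) \<in> borel_measurable P"
      by (intro borel_measurable_blinfun_apply L2_spaceD r w)
    show "(\<lambda>\<omega>. r \<omega> a + (\<Sum>i\<in>UNIV. z i \<omega> * r \<omega> (U i) + y i \<omega> * r \<omega> (A i))) \<in> borel_measurable P"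
      by (intro borel_measurable_integrable Bochner_Integration.integrable_add
          Bochner_Integration.integrable_sum apply_int r_int zr yr')
    show "AE \<omega> in P. r \<omega> (w \<omega>) = r \<omega> a + (\<Sum>i\<in>UNIV. z i \<omega> * r \<omega> (U i) + y i \<omega> * r \<omega> (A i))"
      using repr by eventually_elim (simp add: blinfun.add_right blinfun.sum_right blinfun.scaleR_right)
  qed
  also have "\<dots> = (\<integral>\<omega>. r \<omega> a \<partial>P)
      + (\<Sum>i\<in>UNIV. (\<integral>\<omega>. z i \<omega> * r \<omega> (U i) \<partial>P) + (\<integral>\<omega>. y i \<omega> * r \<omega> (A i) \<partial>P))"
    by (simp add: apply_int r_int zr yr')
  also have "(\<integral>\<omega>. y i \<omega> * r \<omega> (A i) \<partial>P) = 0" for i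
    using apply_integral[OF yr, of i "A i"] ry[of i] by (simp add: blinfun.scaleR_left)
  then have "(\<Sum>i\<in>UNIV. (\<integral>\<omega>. z i \<omega> * r \<omega> (U i) \<partial>P) + (\<integral>\<omega>. y i \<omega> * r \<omega> (A i) \<partial>P)) = 0"
    by (simp add: rz)
  finally show ?thesis by (simp add: apply_integral r_int r0)
qed

text \<open>Time is frozen: \<open>dub\<close>, \<open>dU\<close>, \<open>dy\<close> and
  \<open>du\<close> are plain data linked by \<open>du_eq\<close>, so that only linear algebra and
  expectations remain.\<close>

lemma DLR_residual_orthogonal:
  fixes E :: "'v::{real_inner, banach, second_countable_topology}
      \<Rightarrow>\<^sub>L 'h::{real_inner, banach, second_countable_topology}"
    and U :: "'r::finite \<Rightarrow> 'v" and y dy :: "'r \<Rightarrow> 'w \<Rightarrow> real"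
    and l :: "'w \<Rightarrow> 'v \<Rightarrow>\<^sub>L real" and f :: "'w \<Rightarrow> 'h" and u du :: "'w \<Rightarrow> 'v"
  assumes "prob_space P" and E: "inj (blinfun_apply E)" and U: "inj U" "independent (range U)"
    and y: "\<And>i. y i \<in> L2_space P" and dy: "\<And>i. dy i \<in> L2_space P"
    and l: "l \<in> L2_space P" and f: "f \<in> L2_space P"
    and u: "u \<in> L2_space P" and du: "du \<in> L2_space P"
    and u_eq: "AE \<omega> in P. u \<omega> = ub + (\<Sum>i\<in>UNIV. y i \<omega> *\<^sub>R U i)"
    and du_eq: "AE \<omega> in P. H_form E (du \<omega>)
        = dub + (\<Sum>i\<in>UNIV. dy i \<omega> *\<^sub>R H_form E (U i) + y i \<omega> *\<^sub>R dU i)"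
    and orth: "\<And>i j. (\<integral>\<omega>. y i \<omega> * y j \<omega> \<partial>P) = (if i = j then 1 else 0)"
    and mean: "\<And>j. (\<integral>\<omega>. y j \<omega> \<partial>P) = 0"
    and gauge: "\<And>i j. (\<integral>\<omega>. dy i \<omega> * y j \<omega> \<partial>P) = 0"
    and eq_mean: "\<And>v. dub v + (\<integral>\<omega>. l \<omega> \<partial>P) v = inner (\<integral>\<omega>. f \<omega> \<partial>P) (blinfun_apply E v)"
    and eq_modes: "\<And>j v. dU j v + (\<integral>\<omega>. y j \<omega> *\<^sub>R l \<omega> \<partial>P) v
        = inner (\<integral>\<omega>. y j \<omega> *\<^sub>R f \<omega> \<partial>P) (blinfun_apply E v)"
    and eq_stoch: "\<And>j. AE \<omega> in P. dy j \<omega> + (\<Sum>i\<in>UNIV. matrix_inv (gram E U) $ j $ i *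
        proj_perp P y (\<lambda>\<omega>'. centered P l \<omega>' (U i) - inner (centered P f \<omega>') (E (U i))) \<omega>) = 0"
  defines "r \<equiv> \<lambda>\<omega>. H_form E (du \<omega>) + l \<omega> - H_to_dual E (f \<omega>)"
  shows "(\<integral>\<omega>. blinfun_apply (r \<omega>) (u \<omega>) \<partial>P) = 0"
    and "(\<integral>\<omega>. blinfun_apply (r \<omega>) (du \<omega>) \<partial>P) = 0"
proof -
  interpret prob_space P by fact
  note L1 = L2_space_integrable[OF finite_measure_axioms]
  note prod = L2_space_bilinear_integrable[OF bounded_bilinear_mult]
  note scale = L2_space_bilinear_integrable[OF bounded_bilinear_scaleR]
  note linear_H = bounded_linear_H_to_dual
  have Hdu: "(\<lambda>\<omega>. H_form E (du \<omega>)) \<in> L2_space P"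
    by (rule L2_space_bounded_linear[OF blinfun.bounded_linear_right du])
  have Hf: "(\<lambda>\<omega>. H_to_dual E (f \<omega>)) \<in> L2_space P"
    by (rule L2_space_bounded_linear[OF linear_H f])
  have r: "r \<in> L2_space P"
    unfolding r_def by (intro L2_space_diff L2_space_add Hdu Hf l)

  \<comment> \<open>\<open>g i\<close> is the centred operator term minus the centred forcing,
    tested with U_i; \<open>p i\<close> is its part orthogonal to the y_j. With M the Gram matrix,
    the stochastic equation reads dy = - M^(-1) p.\<close>
  define g where "g = (\<lambda>i \<omega>. centered P l \<omega> (U i) - inner (centered P f \<omega>) (E (U i)))"
  define p where "p = (\<lambda>i. proj_perp P y (g i))"
  have g: "g i \<in> L2_space P" for i
    unfolding g_def centered_def
    by (intro L2_space_diff[of "\<lambda>\<omega>. (l \<omega> - (\<integral>\<omega>. l \<omega> \<partial>P)) (U i)"]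
        L2_space_bounded_linear[OF blinfun.bounded_linear_left]
        L2_space_bounded_linear[OF bounded_linear_inner_left] L2_space_diff l f
        L2_space_const[OF finite_measure_axioms])
  have g_mean: "(\<integral>\<omega>. g i \<omega> \<partial>P) = 0" for i
  proof -
    have l0: "(\<integral>\<omega>. centered P l \<omega> \<partial>P) = 0" and f0: "(\<integral>\<omega>. centered P f \<omega> \<partial>P) = 0"
      using L1[OF l] L1[OF f] by (simp_all add: centered_def prob_space)
    have li: "integrable P (centered P l)" and fi: "integrable P (centered P f)"
      using L1[OF l] L1[OF f] by (simp_all add: centered_def[abs_def])
    show ?thesis
      unfolding g_def
      using integrable_bounded_linear[OF blinfun.bounded_linear_left li, of "U i"]
        integral_bounded_linear[OF blinfun.bounded_linear_left li, of "U i"]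
        integrable_bounded_linear[OF bounded_linear_inner_left fi, of "E (U i)"]
        integral_bounded_linear[OF bounded_linear_inner_left fi, of "E (U i)"]
      by (simp add: l0 f0)
  qed
  have p_eq: "p i \<omega> = g i \<omega> - (\<Sum>j\<in>UNIV. (\<integral>\<omega>. g i \<omega> * y j \<omega> \<partial>P) * y j \<omega>)" for i \<omega>
    by (simp add: p_def proj_perp_def)
  have p_int: "integrable P (p i)" for i
    unfolding p_eq[abs_def] using L1[OF g] L1[OF y] by simp
  have p_mean: "(\<integral>\<omega>. p i \<omega> \<partial>P) = 0" for i
    unfolding p_eq using L1[OF g] L1[OF y] by (simp add: g_mean mean)
  have dy_eq: "AE \<omega> in P. \<forall>j. dy j \<omega> = - (\<Sum>i\<in>UNIV. matrix_inv (gram E U) $ j $ i * p i \<omega>)"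
    unfolding AE_all_countable
  proof
    fix j
    show "AE \<omega> in P. dy j \<omega> = - (\<Sum>i\<in>UNIV. matrix_inv (gram E U) $ j $ i * p i \<omega>)"
      using eq_stoch[of j] by eventually_elim (simp add: p_def g_def eq_neg_iff_add_eq_0)
  qed
  \<comment> \<open>dy is a combination of the \<open>p i\<close>, and these have zero mean because
    \<open>g i\<close> is centred and every y_j subtracted from it has zero mean.\<close>
  have dy_mean: "(\<integral>\<omega>. dy j \<omega> \<partial>P) = 0" for j
  proof -
    have "(\<integral>\<omega>. dy j \<omega> \<partial>P) = (\<integral>\<omega>. - (\<Sum>i\<in>UNIV. matrix_inv (gram E U) $ j $ i * p i \<omega>) \<partial>P)"
      by (rule integral_cong_AE)
        (use L2_spaceD(1)[OF dy] p_int dy_eq in \<open>auto intro!: borel_measurable_integrable\<close>)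
    also have "\<dots> = 0" using p_int by (simp add: p_mean)
    finally show ?thesis .
  qed
  \<comment> \<open>Multiplying by M returns to the variational form M dy = - p, one scalar equation
    for each test vector U_i.\<close>
  have gram_dy: "AE \<omega> in P. \<forall>i. (\<Sum>k\<in>UNIV. dy k \<omega> * inner (E (U k)) (E (U i))) = - p i \<omega>"
    using dy_eq
  proof eventually_elim
    case (elim \<omega>)
    show ?case
    proof
      fix i
      have "(\<Sum>k\<in>UNIV. dy k \<omega> * inner (E (U k)) (E (U i)))
          = (\<Sum>k\<in>UNIV. gram E U $ i $ k * dy k \<omega>)"
        by (simp add: gram_def inner_commute mult.commute)
      also have "\<dots> = - (\<Sum>k\<in>UNIV. \<Sum>m\<in>UNIV. gram E U $ i $ k * matrix_inv (gram E U) $ k $ m * p m \<omega>)"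
        using elim by (simp add: sum_distrib_left sum_negf mult.assoc)
      also have "(\<Sum>k\<in>UNIV. \<Sum>m\<in>UNIV. gram E U $ i $ k * matrix_inv (gram E U) $ k $ m * p m \<omega>)
          = (\<Sum>m\<in>UNIV. (gram E U ** matrix_inv (gram E U)) $ i $ m * p m \<omega>)"
        by (subst sum.swap) (simp add: matrix_matrix_mult_def sum_distrib_right)
      also have "\<dots> = (\<Sum>m\<in>UNIV. if i = m then p m \<omega> else 0)"
        unfolding matrix_mul_matrix_inv[OF invertible_gram[OF E U]]
        by (intro sum.cong) (auto simp: mat_def)
      also have "\<dots> = p i \<omega>" by simp
      finally show "(\<Sum>k\<in>UNIV. dy k \<omega> * inner (E (U k)) (E (U i))) = - p i \<omega>" .
    qed
  qed

  \<comment> \<open>Integrating \<open>du_eq\<close> against 1 and then against y_j isolates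
    \<open>dub\<close> and \<open>dU j\<close>: zero means and the gauge condition remove the other
    terms, and orthonormality selects one index.\<close>
  have mean_du: "(\<integral>\<omega>. H_form E (du \<omega>) \<partial>P) = dub"
  proof -
    have "(\<integral>\<omega>. H_form E (du \<omega>) \<partial>P)
        = (\<integral>\<omega>. dub + (\<Sum>i\<in>UNIV. dy i \<omega> *\<^sub>R H_form E (U i) + y i \<omega> *\<^sub>R dU i) \<partial>P)"
      by (rule integral_cong_AE)
        (use L2_spaceD(1)[OF Hdu] du_eq L2_spaceD(1)[OF y] L2_spaceD(1)[OF dy] in auto)
    also have "\<dots> = dub"
      using L1[OF dy] L1[OF y] by (simp add: dy_mean mean prob_space)
    finally show ?thesis .
  qed
  have mode_du: "(\<integral>\<omega>. y j \<omega> *\<^sub>R H_form E (du \<omega>) \<partial>P) = dU j" for j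
  proof -
    have "(\<integral>\<omega>. y j \<omega> *\<^sub>R H_form E (du \<omega>) \<partial>P)
        = (\<integral>\<omega>. y j \<omega> *\<^sub>R dub + (\<Sum>i\<in>UNIV. (dy i \<omega> * y j \<omega>) *\<^sub>R H_form E (U i) + (y i \<omega> * y j \<omega>) *\<^sub>R dU i) \<partial>P)"
    proof (rule integral_cong_AE)
      show "AE \<omega> in P. y j \<omega> *\<^sub>R H_form E (du \<omega>)
        = y j \<omega> *\<^sub>R dub + (\<Sum>i\<in>UNIV. (dy i \<omega> * y j \<omega>) *\<^sub>R H_form E (U i) + (y i \<omega> * y j \<omega>) *\<^sub>R dU i)"
        using du_eq by eventually_elim (simp add: scaleR_add_right scaleR_sum_right mult.commute)
    qed (use L2_spaceD(1)[OF Hdu] L2_spaceD(1)[OF y] L2_spaceD(1)[OF dy] in auto)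
    also have "\<dots> = (\<Sum>i\<in>UNIV. (if i = j then 1 else 0 :: real) *\<^sub>R dU i)"
      using L1[OF y] prod[OF dy y] prod[OF y y] by (simp add: mean gauge orth)
    also have "\<dots> = (\<Sum>i\<in>UNIV. if i = j then dU i else 0)" by (intro sum.cong) auto
    also have "\<dots> = dU j" by simp
    finally show ?thesis .
  qed

  have r0: "(\<integral>\<omega>. r \<omega> \<partial>P) = 0"
  proof (rule blinfun_eqI)
    fix v
    have "(\<integral>\<omega>. r \<omega> \<partial>P) = dub + (\<integral>\<omega>. l \<omega> \<partial>P) - H_to_dual E (\<integral>\<omega>. f \<omega> \<partial>P)"
      unfolding r_def using L1[OF Hdu] L1[OF l] L1[OF Hf]
      by (simp add: mean_du integral_bounded_linear[OF linear_H L1[OF f]])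
    then show "(\<integral>\<omega>. r \<omega> \<partial>P) v = blinfun_apply 0 v"
      using eq_mean[of v] by (simp add: blinfun.add_left blinfun.diff_left H_to_dual_apply)
  qed
  have ry: "(\<integral>\<omega>. y j \<omega> *\<^sub>R r \<omega> \<partial>P) = 0" for j
  proof (rule blinfun_eqI)
    fix v
    have "y j \<omega> *\<^sub>R r \<omega> = y j \<omega> *\<^sub>R H_form E (du \<omega>) + y j \<omega> *\<^sub>R l \<omega> - H_to_dual E (y j \<omega> *\<^sub>R f \<omega>)" for \<omega>
      by (simp add: r_def algebra_simps linear_scale[OF bounded_linear.linear[OF linear_H]])
    then have "(\<integral>\<omega>. y j \<omega> *\<^sub>R r \<omega> \<partial>P) = dU j + (\<integral>\<omega>. y j \<omega> *\<^sub>R l \<omega> \<partial>P) - H_to_dual E (\<integral>\<omega>. y j \<omega> *\<^sub>R f \<omega> \<partial>P)"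
      by (simp only: Bochner_Integration.integral_diff[OF Bochner_Integration.integrable_add[OF
              scale[OF y Hdu] scale[OF y l]] integrable_bounded_linear[OF linear_H scale[OF y f]]]
          Bochner_Integration.integral_add[OF scale[OF y Hdu] scale[OF y l]]
          integral_bounded_linear[OF linear_H scale[OF y f]] mode_du)
    then show "(\<integral>\<omega>. y j \<omega> *\<^sub>R r \<omega> \<partial>P) v = blinfun_apply 0 v"
      using eq_modes[of j v] by (simp add: blinfun.add_left blinfun.diff_left H_to_dual_apply)
  qed

  have rdy: "(\<integral>\<omega>. dy i \<omega> * r \<omega> (U i) \<partial>P) = 0" for i
  proof -
    \<comment> \<open>By \<open>gram_dy\<close>, r(U_i) equals g_i - p_i up to deterministic terms
      and multiples of the y_k, and g_i - p_i is itself a combination of the y_k. Collecting terms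
      gives the constant \<open>a\<close> and the coefficients \<open>b k\<close>; against dy_i the
      former vanishes by zero mean, the latter by the gauge condition.\<close>
    define a where "a = dub (U i) + (\<integral>\<omega>. l \<omega> \<partial>P) (U i) - inner (\<integral>\<omega>. f \<omega> \<partial>P) (E (U i))"
    define b where "b = (\<lambda>k. dU k (U i) + (\<integral>\<omega>. g i \<omega> * y k \<omega> \<partial>P))"
    have "AE \<omega> in P. dy i \<omega> * r \<omega> (U i) = dy i \<omega> * a + (\<Sum>k\<in>UNIV. (dy i \<omega> * y k \<omega>) * b k)"
      using du_eq gram_dy
    proof eventually_elim
      case (elim \<omega>)
      have "r \<omega> (U i) = dub (U i) + ((\<Sum>k\<in>UNIV. dy k \<omega> * inner (E (U k)) (E (U i)))
          + (\<Sum>k\<in>UNIV. y k \<omega> * dU k (U i))) + l \<omega> (U i) - inner (f \<omega>) (E (U i))"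
        by (simp add: r_def elim(1) blinfun.add_left blinfun.diff_left blinfun.sum_left blinfun.scaleR_left
            H_form_apply_apply H_to_dual_apply sum.distrib)
      also have "(\<Sum>k\<in>UNIV. dy k \<omega> * inner (E (U k)) (E (U i))) = - p i \<omega>" using elim(2) by simp
      also have "dub (U i) + (- p i \<omega> + (\<Sum>k\<in>UNIV. y k \<omega> * dU k (U i))) + l \<omega> (U i) - inner (f \<omega>) (E (U i))
          = a + (\<Sum>k\<in>UNIV. y k \<omega> * b k)"
        by (simp add: p_eq g_def a_def b_def centered_def blinfun.diff_left inner_diff_left
            distrib_left sum.distrib mult.commute)
      finally show ?case by (simp add: distrib_left sum_distrib_left mult.assoc)
    qed
    then have "(\<integral>\<omega>. dy i \<omega> * r \<omega> (U i) \<partial>P) = (\<integral>\<omega>. dy i \<omega> * a + (\<Sum>k\<in>UNIV. (dy i \<omega> * y k \<omega>) * b k) \<partial>P)"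
      using L2_spaceD(1)[OF y] L2_spaceD(1)[OF dy]
        L2_spaceD(1)[OF L2_space_bounded_linear[OF blinfun.bounded_linear_left r], of "U i"]
      by (intro integral_cong_AE) auto
    also have "\<dots> = 0"
      using L1[OF dy] prod[OF dy y] by (simp add: dy_mean gauge)
    finally show ?thesis .
  qed

  \<comment> \<open>u is its own tangent direction, with zero stochastic variation and A =
    U.\<close>
  show "(\<integral>\<omega>. blinfun_apply (r \<omega>) (u \<omega>) \<partial>P) = 0"
    by (rule expectation_pairing_zero[where z = "\<lambda>_ _. 0" and A = U and a = ub and U = U,
          OF assms(1) r u y L2_space_const[OF finite_measure_axioms] r0 ry])
      (use u_eq in auto)

  \<comment> \<open>The missing coefficients in V: \<open>du\<close> is V-valued, so its mean and
    its moments against y_i are Bochner integrals in V. \<open>H_form E\<close> maps them to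
    \<open>dub\<close> and \<open>dU i\<close>, and injectivity carries the product rule from V'
    back to V.\<close>
  define a where "a = (\<integral>\<omega>. du \<omega> \<partial>P)"
  define A where "A = (\<lambda>i. \<integral>\<omega>. y i \<omega> *\<^sub>R du \<omega> \<partial>P)"
  have a: "H_form E a = dub"
    using mean_du by (simp add: a_def integral_bounded_linear[OF blinfun.bounded_linear_right L1[OF du]])
  have A: "H_form E (A i) = dU i" for i
    using mode_du[of i] integral_bounded_linear[OF blinfun.bounded_linear_right scale[OF y du], of "H_form E" i]
    by (simp add: A_def blinfun.scaleR_right)
  have "AE \<omega> in P. du \<omega> = a + (\<Sum>i\<in>UNIV. dy i \<omega> *\<^sub>R U i + y i \<omega> *\<^sub>R A i)"
    using du_eq
  proof eventually_elim
    case (elim \<omega>)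
    have "H_form E (du \<omega> - (a + (\<Sum>i\<in>UNIV. dy i \<omega> *\<^sub>R U i + y i \<omega> *\<^sub>R A i))) = 0"
      by (simp add: elim blinfun.diff_right blinfun.add_right blinfun.sum_right blinfun.scaleR_right a A)
    then show ?case by (simp add: H_form_eq_0_iff[OF E])
  qed
  then show "(\<integral>\<omega>. blinfun_apply (r \<omega>) (du \<omega>) \<partial>P) = 0"
    by (rule expectation_pairing_zero[OF assms(1) r du y dy r0 ry rdy])
qed

section \<open>The energy estimates\<close>

lemma primitive_antimono:
  fixes k :: "real \<Rightarrow> real"
  assumes k: "integrable (time_interval T) k" and neg: "AE s in time_interval T. k s \<le> 0"
    and "t1 \<le> t2"
  shows "primitive T k t2 \<le> primitive T k t1"
  unfolding primitive_def set_lebesgue_integral_def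
proof (rule integral_mono_AE)
  show "AE s in time_interval T. indicator {0..t2} s *\<^sub>R k s \<le> indicator {0..t1} s *\<^sub>R k s"
    using neg by eventually_elim (use \<open>t1 \<le> t2\<close> in \<open>auto split: split_indicator\<close>)
qed (intro integrable_indicator_time k)+

lemma primitive_full: "primitive T g T = (\<integral>s. g s \<partial>time_interval T)"
  unfolding primitive_def set_lebesgue_integral_def
  by (rule Bochner_Integration.integral_cong) auto

lemma L2_norm_zero: "(AE \<omega> in P. v \<omega> = 0) \<Longrightarrow> L2_norm P v = 0"
  unfolding L2_norm_def by (subst integral_eq_zero_AE) auto

lemma energy_form_H_form:
  "energy_form P (\<lambda>_. H_form E) v v = (L2_norm P (\<lambda>\<omega>. blinfun_apply E (v \<omega>)))\<^sup>2"
  by (simp add: energy_form_def random_op_def H_form_apply_apply L2_norm_def power2_norm_eq_inner)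

text \<open>\<open>energy_norm\<close> is a square root, so its square returns the form only where
  the form is non-negative.\<close>

lemma energy_form_coercive:
  assumes "\<And>\<omega> v. \<omega> \<in> space P \<Longrightarrow> blinfun_apply (blinfun_apply (L \<omega>) v) v \<ge> C_L * (norm v)\<^sup>2"
    and "C_L > 0"
  shows "energy_form P L v v \<ge> 0"
  unfolding energy_form_def random_op_def
proof (rule Bochner_Integration.integral_nonneg)
  fix \<omega> assume "\<omega> \<in> space P"
  then show "0 \<le> L \<omega> (v \<omega>) (v \<omega>)"
    using assms(1)[of \<omega> "v \<omega>"] assms(2) by (smt (verit) mult_nonneg_nonneg zero_le_power2)
qed

text \<open>Energy balance at one fixed time: expanding r against w relates (u',w), the L form and
  (f,w). With w = u or w = u', Young's inequality splits the forcing so that a good term absorbs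
  half of itself.\<close>

lemma residual_energy_bounds:
  fixes E :: "'v::{real_inner, banach, second_countable_topology}
      \<Rightarrow>\<^sub>L 'h::{real_inner, banach, second_countable_topology}"
    and L :: "'w \<Rightarrow> 'v \<Rightarrow>\<^sub>L ('v \<Rightarrow>\<^sub>L real)" and f :: "'w \<Rightarrow> 'h" and u du :: "'w \<Rightarrow> 'v"
  assumes E_bound: "\<And>v. norm (blinfun_apply E v) \<le> C_P * norm v" and "C_P > 0"
    and L: "L \<in> borel_measurable P" and "C_L > 0"
    and coercive: "\<And>\<omega> v. \<omega> \<in> space P \<Longrightarrow> blinfun_apply (blinfun_apply (L \<omega>) v) v \<ge> C_L * (norm v)\<^sup>2"
    and bound: "\<And>\<omega> v. \<omega> \<in> space P \<Longrightarrow> norm (blinfun_apply (L \<omega>) v) \<le> C_B * norm v"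
    and f: "f \<in> L2_space P" and u: "u \<in> L2_space P" and du: "du \<in> L2_space P"
  defines "r \<equiv> \<lambda>\<omega>. H_form E (du \<omega>) + random_op L u \<omega> - H_to_dual E (f \<omega>)"
  shows "(\<integral>\<omega>. blinfun_apply (r \<omega>) (u \<omega>) \<partial>P) = 0 \<Longrightarrow>
      energy_form P (\<lambda>_. H_form E) du u + energy_form P (\<lambda>_. H_form E) u du
      \<le> C_P\<^sup>2 / C_L * (L2_norm P f)\<^sup>2 - C_L * (L2_norm P u)\<^sup>2" (is "?A \<Longrightarrow> ?B")
    and "(\<integral>\<omega>. blinfun_apply (r \<omega>) (du \<omega>) \<partial>P) = 0 \<Longrightarrow>
      2 * energy_form P L u du
      \<le> (L2_norm P f)\<^sup>2 - (L2_norm P (\<lambda>\<omega>. blinfun_apply E (du \<omega>)))\<^sup>2" (is "?C \<Longrightarrow> ?D")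
proof -
  note inner_int = L2_space_bilinear_integrable[OF bounded_bilinear_inner]
  have Ew: "(\<lambda>\<omega>. E (w \<omega>)) \<in> L2_space P" if "w \<in> L2_space P" for w
    by (rule L2_space_bounded_linear[OF blinfun.bounded_linear_right that])
  have r_w: "(\<integral>\<omega>. blinfun_apply (r \<omega>) (w \<omega>) \<partial>P)
      = (\<integral>\<omega>. inner (E (du \<omega>)) (E (w \<omega>)) \<partial>P) + energy_form P L u w - (\<integral>\<omega>. inner (f \<omega>) (E (w \<omega>)) \<partial>P)"
    if w: "w \<in> L2_space P" for w
    unfolding r_def energy_form_def
    using inner_int[OF Ew[OF du] Ew[OF w]] inner_int[OF f Ew[OF w]] energy_form_integrable[OF L bound u w]
    by (simp add: blinfun.add_left blinfun.diff_left H_form_apply_apply H_to_dual_apply)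
  have sq: "(L2_norm P w)\<^sup>2 = (\<integral>\<omega>. (norm (w \<omega>))\<^sup>2 \<partial>P)" for w :: "'w \<Rightarrow> 'x::real_normed_vector"
    by (simp add: L2_norm_def)
  show ?B if ?A
  proof -
    have "2 * (\<integral>\<omega>. inner (f \<omega>) (E (u \<omega>)) \<partial>P)
        \<le> (\<integral>\<omega>. C_P\<^sup>2 / C_L * (norm (f \<omega>))\<^sup>2 + C_L * (norm (u \<omega>))\<^sup>2 \<partial>P)"
      unfolding integral_mult_right_zero[symmetric]
    proof (rule integral_mono)
      fix \<omega>
      \<comment> \<open>The factor \<open>sqrt C_L\<close> is distributed so that |u|^2 receives the
        weight C_L, half of the 2 C_L from coercivity; this forces the weight
        \<open>C_P\<^sup>2 / C_L\<close> on |f|^2.\<close>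
      have "2 * inner (f \<omega>) (E (u \<omega>)) \<le> 2 * (norm (f \<omega>) * (C_P * norm (u \<omega>)))"
        using norm_cauchy_schwarz[of "f \<omega>" "E (u \<omega>)"] mult_left_mono[OF E_bound[of "u \<omega>"], of "norm (f \<omega>)"]
        by simp
      also have "\<dots> = 2 * (C_P / sqrt C_L * norm (f \<omega>)) * (sqrt C_L * norm (u \<omega>))"
        using \<open>C_L > 0\<close> by simp
      also have "\<dots> \<le> (C_P / sqrt C_L * norm (f \<omega>))\<^sup>2 + (sqrt C_L * norm (u \<omega>))\<^sup>2"
        by (rule sum_squares_bound)
      also have "\<dots> = C_P\<^sup>2 / C_L * (norm (f \<omega>))\<^sup>2 + C_L * (norm (u \<omega>))\<^sup>2"
        using \<open>C_L > 0\<close> by (simp add: power_mult_distrib power_divide)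
      finally show "2 * inner (f \<omega>) (E (u \<omega>)) \<le> C_P\<^sup>2 / C_L * (norm (f \<omega>))\<^sup>2 + C_L * (norm (u \<omega>))\<^sup>2" .
    qed (use inner_int[OF f Ew[OF u]] L2_spaceD(2)[OF f] L2_spaceD(2)[OF u] in auto)
    also have "\<dots> = C_P\<^sup>2 / C_L * (L2_norm P f)\<^sup>2 + C_L * (L2_norm P u)\<^sup>2"
      using L2_spaceD(2)[OF f] L2_spaceD(2)[OF u] by (simp add: sq)
    finally have 1: "2 * (\<integral>\<omega>. inner (f \<omega>) (E (u \<omega>)) \<partial>P)
        \<le> C_P\<^sup>2 / C_L * (L2_norm P f)\<^sup>2 + C_L * (L2_norm P u)\<^sup>2" .
    have 2: "C_L * (L2_norm P u)\<^sup>2 \<le> energy_form P L u u"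
      unfolding sq energy_form_def integral_mult_right_zero[symmetric]
      by (rule integral_mono)
        (use L2_spaceD(2)[OF u] energy_form_integrable[OF L bound u u] coercive in \<open>auto simp: random_op_def\<close>)
    have "energy_form P (\<lambda>_. H_form E) du u + energy_form P (\<lambda>_. H_form E) u du
        = 2 * (\<integral>\<omega>. inner (E (du \<omega>)) (E (u \<omega>)) \<partial>P)"
      by (simp add: energy_form_def random_op_def H_form_apply_apply inner_commute)
    then show ?thesis using 1 2 r_w[OF u] that by linarith
  qed
  show ?D if ?C
  proof -
    \<comment> \<open>Here weight 1 is right: the doubled balance contains 2 |E u'|^2, and one copy
      absorbs this term.\<close>
    have "2 * (\<integral>\<omega>. inner (f \<omega>) (E (du \<omega>)) \<partial>P)
        \<le> (\<integral>\<omega>. (norm (f \<omega>))\<^sup>2 + (norm (E (du \<omega>)))\<^sup>2 \<partial>P)"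
      unfolding integral_mult_right_zero[symmetric]
    proof (rule integral_mono)
      fix \<omega>
      show "2 * inner (f \<omega>) (E (du \<omega>)) \<le> (norm (f \<omega>))\<^sup>2 + (norm (E (du \<omega>)))\<^sup>2"
        using norm_cauchy_schwarz[of "f \<omega>" "E (du \<omega>)"]
          sum_squares_bound[of "norm (f \<omega>)" "norm (E (du \<omega>))"] by linarith
    qed (use inner_int[OF f Ew[OF du]] L2_spaceD(2)[OF f] L2_spaceD(2)[OF Ew[OF du]] in auto)
    also have "\<dots> = (L2_norm P f)\<^sup>2 + (L2_norm P (\<lambda>\<omega>. E (du \<omega>)))\<^sup>2"
      using L2_spaceD(2)[OF f] L2_spaceD(2)[OF Ew[OF du]] by (simp add: sq)
    finally have 1: "2 * (\<integral>\<omega>. inner (f \<omega>) (E (du \<omega>)) \<partial>P)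
        \<le> (L2_norm P f)\<^sup>2 + (L2_norm P (\<lambda>\<omega>. E (du \<omega>)))\<^sup>2" .
    have "(\<integral>\<omega>. inner (E (du \<omega>)) (E (du \<omega>)) \<partial>P) = (L2_norm P (\<lambda>\<omega>. E (du \<omega>)))\<^sup>2"
      by (simp add: sq power2_norm_eq_inner)
    then show ?thesis using 1 r_w[OF du] that by linarith
  qed
qed

theorem theorem5p2:
  fixes P :: "'w measure"
    and E :: "'v::{real_inner, banach, second_countable_topology}
              \<Rightarrow>\<^sub>L 'h::{real_inner, banach, second_countable_topology}"
    and L :: "'w \<Rightarrow> ('v \<Rightarrow>\<^sub>L ('v \<Rightarrow>\<^sub>L real))"
    and f :: "real \<Rightarrow> 'w \<Rightarrow> 'h"
    and C_P C_L C_B T :: real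
    and ubar :: "real \<Rightarrow> 'v" and dubar :: "real \<Rightarrow> ('v \<Rightarrow>\<^sub>L real)"
    and U :: "'r::finite \<Rightarrow> real \<Rightarrow> 'v" and dU :: "'r \<Rightarrow> real \<Rightarrow> ('v \<Rightarrow>\<^sub>L real)"
    and Y dY :: "'r \<Rightarrow> real \<Rightarrow> 'w \<Rightarrow> real"
    and u du :: "real \<Rightarrow> 'w \<Rightarrow> 'v"
  assumes "prob_space P"
    and "gelfand_triple E"
    and "C_P > 0" and "\<And>v. norm (blinfun_apply E v) \<le> C_P * norm v"
    and "L \<in> borel_measurable P"
    and "C_L > 0"
    and "\<And>\<omega> v. \<omega> \<in> space P \<Longrightarrow> blinfun_apply (blinfun_apply (L \<omega>) v) v \<ge> C_L * (norm v)\<^sup>2"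
    and "C_B > 0"
    and "\<And>\<omega> v w. \<omega> \<in> space P \<Longrightarrow>
           blinfun_apply (blinfun_apply (L \<omega>) v) w \<le> C_B * norm v * norm w"
    and "T > 0"
    and "f \<in> L2_time P T"
    and "DLR_solution P T E L f ubar dubar U dU Y dY u"
    and "u \<in> L2_time P T"
    and "time_derivative_L2 P T u du" and "du \<in> L2_time P T"
  shows
    "(L2_norm P (\<lambda>\<omega>. blinfun_apply E (u T \<omega>)))\<^sup>2
       + C_L * (LINT t:{0..T}|lborel. (L2_norm P (u t))\<^sup>2)
       \<le> (L2_norm P (\<lambda>\<omega>. blinfun_apply E (u 0 \<omega>)))\<^sup>2
         + C_P\<^sup>2 / C_L * (L2_time_norm P T f)\<^sup>2
     \<and> (symmetric_op P L \<longrightarrow>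
         (energy_norm P L (u T))\<^sup>2
           + (LINT t:{0..T}|lborel. (L2_norm P (\<lambda>\<omega>. blinfun_apply E (du t \<omega>)))\<^sup>2)
           \<le> (energy_norm P L (u 0))\<^sup>2 + (L2_time_norm P T f)\<^sup>2)
     \<and> ((AE t in time_interval T. AE \<omega> in P. f t \<omega> = 0) \<longrightarrow>
         (\<forall>t1 t2. 0 \<le> t1 \<and> t1 \<le> t2 \<and> t2 \<le> T \<longrightarrow>
            L2_norm P (\<lambda>\<omega>. blinfun_apply E (u t2 \<omega>)) \<le> L2_norm P (\<lambda>\<omega>. blinfun_apply E (u t1 \<omega>))
            \<and> (symmetric_op P L \<longrightarrow> energy_norm P L (u t2) \<le> energy_norm P L (u t1))))"
proof -
  let ?M = "time_interval T"
  interpret prob_space P by fact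
  have E: "inj (blinfun_apply E)" using assms(2) by (simp add: gelfand_triple_def)
  \<comment> \<open>The one-sided bound on the form, used at w and at -w, becomes a bound on the V'
    norm.\<close>
  have L_bound: "norm (blinfun_apply (L \<omega>) v) \<le> C_B * norm v" if \<omega>: "\<omega> \<in> space P" for \<omega> v
  proof (rule norm_blinfun_bound)
    show "0 \<le> C_B * norm v" using \<open>C_B > 0\<close> by simp
    fix w
    show "norm (L \<omega> v w) \<le> C_B * norm v * norm w"
      using assms(9)[OF \<omega>, of v w] assms(9)[OF \<omega>, of v "- w"] by (simp add: blinfun.minus_right)
  qed
  note Du = time_derivative_L2D[OF assms(14)]
  note DLR = assms(12)[unfolded DLR_solution_def]
  have A: "time_derivative T (\<lambda>t. H_form E (ubar t)) dubar"
    and B: "\<And>i. time_derivative T (\<lambda>t. H_form E (U i t)) (dU i)"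
    and Y: "\<And>i. time_derivative_L2 P T (Y i) (dY i)"
    using DLR by (simp_all add: H_form_apply)
  have at: "AE \<omega> in P. u t \<omega> = ubar t + (\<Sum>i\<in>UNIV. Y i t \<omega> *\<^sub>R U i t)"
      "inj (\<lambda>i. U i t)" "independent (range (\<lambda>i. U i t))"
      "\<And>i j. (\<integral>\<omega>. Y i t \<omega> * Y j t \<omega> \<partial>P) = (if i = j then 1 else 0)"
      "\<And>j. (\<integral>\<omega>. Y j t \<omega> \<partial>P) = 0"
    if "t \<in> {0..T}" for t
    using DLR that by blast+
  have eqs: "AE t in ?M.
        (\<forall>i j. (\<integral>\<omega>. dY i t \<omega> * Y j t \<omega> \<partial>P) = 0) \<and>
        (\<forall>v. dubar t v + (\<integral>\<omega>. random_op L (u t) \<omega> \<partial>P) v = inner (\<integral>\<omega>. f t \<omega> \<partial>P) (E v)) \<and>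
        (\<forall>j v. dU j t v + (\<integral>\<omega>. Y j t \<omega> *\<^sub>R random_op L (u t) \<omega> \<partial>P) v
             = inner (\<integral>\<omega>. Y j t \<omega> *\<^sub>R f t \<omega> \<partial>P) (E v)) \<and>
        (\<forall>j. AE \<omega> in P. dY j t \<omega> + (\<Sum>i\<in>UNIV. matrix_inv (gram E (\<lambda>k. U k t)) $ j $ i *
                  proj_perp P (\<lambda>k. Y k t)
                    (\<lambda>\<omega>'. blinfun_apply (centered P (random_op L (u t)) \<omega>') (U i t)
                         - inner (centered P (f t) \<omega>') (E (U i t))) \<omega>) = 0)"
    using DLR by blast
  \<comment> \<open>The mean and the modes are differentiable in V', so the product rule is applied
    to the image of u under \<open>H_form E\<close>.\<close>
  have du_eq: "AE t in ?M. AE \<omega> in P. H_form E (du t \<omega>)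
      = dubar t + (\<Sum>i\<in>UNIV. dY i t \<omega> *\<^sub>R H_form E (U i t) + Y i t \<omega> *\<^sub>R dU i t)"
  proof (rule low_rank_derivative[OF assms(1) blinfun.bounded_linear_right assms(14) Y A B])
    fix t assume "t \<in> {0..T}"
    from at(1)[OF this] show "AE \<omega> in P. H_form E (u t \<omega>)
        = H_form E (ubar t) + (\<Sum>i\<in>UNIV. Y i t \<omega> *\<^sub>R H_form E (U i t))"
      by eventually_elim (simp add: blinfun.add_right blinfun.sum_right blinfun.scaleR_right)
  qed
  have dY_L2: "AE t in ?M. \<forall>i. dY i t \<in> L2_space P"
    unfolding AE_all_countable using time_derivative_L2D(2)[OF Y] by blast

  have key: "AE t in ?M. du t \<in> L2_space P \<and> u t \<in> L2_space P
      \<and> energy_form P (\<lambda>_. H_form E) (du t) (u t) + energy_form P (\<lambda>_. H_form E) (u t) (du t)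
        \<le> C_P\<^sup>2 / C_L * (L2_norm P (f t))\<^sup>2 - C_L * (L2_norm P (u t))\<^sup>2
      \<and> 2 * energy_form P L (u t) (du t)
        \<le> (L2_norm P (f t))\<^sup>2 - (L2_norm P (\<lambda>\<omega>. E (du t \<omega>)))\<^sup>2"
    using eqs du_eq dY_L2 Du(2) L2_timeD(1)[OF assms(1) assms(11)] AE_space
  proof eventually_elim
    case (elim t)
    then have t: "t \<in> {0..T}" by simp
    note u = Du(4)[OF t] and du = elim(4) and f = elim(5)
    note orth = DLR_residual_orthogonal[OF assms(1) E at(2,3)[OF t] time_derivative_L2D(4)[OF Y t]
        elim(3)[rule_format] random_op_L2[OF assms(5) L_bound u] f u du at(1)[OF t] elim(2) at(4,5)[OF t]]
    have "(\<integral>\<omega>. blinfun_apply (H_form E (du t \<omega>) + random_op L (u t) \<omega> - H_to_dual E (f t \<omega>)) (u t \<omega>) \<partial>P) = 0"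
      "(\<integral>\<omega>. blinfun_apply (H_form E (du t \<omega>) + random_op L (u t) \<omega> - H_to_dual E (f t \<omega>)) (du t \<omega>) \<partial>P) = 0"
      using elim(1) by (intro orth; blast)+
    then show ?case
      using residual_energy_bounds[OF assms(4,3,5,6,7) L_bound f u du] u du by blast
  qed

  define kH where "kH = (\<lambda>t. energy_form P (\<lambda>_. H_form E) (du t) (u t) + energy_form P (\<lambda>_. H_form E) (u t) (du t))"
  define kL where "kL = (\<lambda>t. energy_form P L (du t) (u t) + energy_form P L (u t) (du t))"
  \<comment> \<open>\<open>norm_blinfun\<close> fixes the uniform bound: \<open>C\<close> is the
    operator norm of \<open>H_form E\<close>.\<close>
  note H_deriv = energy_form_derivative[where K = "\<lambda>_. H_form E",
      OF assms(1) borel_measurable_const norm_blinfun assms(13,15,14), folded kH_def]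
  note kH_int = H_deriv(1)
  have kL_int: "integrable ?M kL"
    unfolding kL_def by (rule energy_form_derivative(1)[OF assms(1,5) L_bound assms(13,15,14)])
  have H_energy: "(L2_norm P (\<lambda>\<omega>. E (u t \<omega>)))\<^sup>2
      = (L2_norm P (\<lambda>\<omega>. E (u 0 \<omega>)))\<^sup>2 + primitive T kH t" if "t \<in> {0..T}" for t
    unfolding energy_form_H_form[symmetric] by (rule H_deriv(2)[OF that])
  have "(energy_norm P L v)\<^sup>2 = energy_form P L v v" for v
    using energy_form_coercive[where P = P and L = L and C_L = C_L, OF assms(7,6)] by (simp add: energy_norm_def)
  then have L_energy: "(energy_norm P L (u t))\<^sup>2 = (energy_norm P L (u 0))\<^sup>2 + primitive T kL t"
    if "t \<in> {0..T}" for t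
    using energy_form_derivative(2)[OF assms(1,5) L_bound assms(13,15,14) that] unfolding kL_def by presburger
  have kH_le: "AE t in ?M. kH t \<le> C_P\<^sup>2 / C_L * (L2_norm P (f t))\<^sup>2 - C_L * (L2_norm P (u t))\<^sup>2"
    using key by eventually_elim (simp add: kH_def)
  \<comment> \<open>Symmetry enters here: it makes \<open>kL\<close> twice the form bounded in
    \<open>key\<close>.\<close>
  have kL_le: "AE t in ?M. kL t \<le> (L2_norm P (f t))\<^sup>2 - (L2_norm P (\<lambda>\<omega>. E (du t \<omega>)))\<^sup>2"
    if "symmetric_op P L"
    using key
  proof eventually_elim
    case (elim t)
    then have "energy_form P L (du t) (u t) = energy_form P L (u t) (du t)"
      using that by (simp add: symmetric_op_def)
    then show ?case using elim by (simp add: kL_def)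
  qed
  have Edu: "(\<lambda>t \<omega>. E (du t \<omega>)) \<in> L2_time P T"
    using L2_space_bounded_linear[OF blinfun.bounded_linear_right, of "\<lambda>(t, \<omega>). du t \<omega>" "?M \<Otimes>\<^sub>M P" E] assms(15)
    by (simp add: L2_time_def split_beta')
  note f_int = L2_timeD(2,3)[OF assms(1) assms(11)]
    and u_int = L2_timeD(2)[OF assms(1) assms(13)]
    and Edu_int = L2_timeD(2)[OF assms(1) Edu]

  have claim1: "(L2_norm P (\<lambda>\<omega>. E (u T \<omega>)))\<^sup>2 + C_L * (LINT t:{0..T}|lborel. (L2_norm P (u t))\<^sup>2)
       \<le> (L2_norm P (\<lambda>\<omega>. E (u 0 \<omega>)))\<^sup>2 + C_P\<^sup>2 / C_L * (L2_time_norm P T f)\<^sup>2"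
  proof -
    have "primitive T kH T
        \<le> (\<integral>t. C_P\<^sup>2 / C_L * (L2_norm P (f t))\<^sup>2 - C_L * (L2_norm P (u t))\<^sup>2 \<partial>?M)"
      unfolding primitive_full
      by (rule integral_mono_AE[OF kH_int _ kH_le])
        (intro Bochner_Integration.integrable_diff integrable_mult_right f_int u_int)
    also have "\<dots> = C_P\<^sup>2 / C_L * (L2_time_norm P T f)\<^sup>2 - C_L * (LINT t:{0..T}|lborel. (L2_norm P (u t))\<^sup>2)"
      unfolding set_integral_time_interval_full f_int(2)
      by (subst Bochner_Integration.integral_diff) (use f_int(1) u_int in auto)
    finally show ?thesis using H_energy[of T] \<open>T > 0\<close> by simp
  qed
  have claim2: "(energy_norm P L (u T))\<^sup>2 + (LINT t:{0..T}|lborel. (L2_norm P (\<lambda>\<omega>. E (du t \<omega>)))\<^sup>2)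
       \<le> (energy_norm P L (u 0))\<^sup>2 + (L2_time_norm P T f)\<^sup>2" if "symmetric_op P L"
  proof -
    have "primitive T kL T \<le> (\<integral>t. (L2_norm P (f t))\<^sup>2 - (L2_norm P (\<lambda>\<omega>. E (du t \<omega>)))\<^sup>2 \<partial>?M)"
      unfolding primitive_full
      by (rule integral_mono_AE[OF kL_int _ kL_le[OF that]])
        (intro Bochner_Integration.integrable_diff f_int Edu_int)
    also have "\<dots> = (L2_time_norm P T f)\<^sup>2 - (LINT t:{0..T}|lborel. (L2_norm P (\<lambda>\<omega>. E (du t \<omega>)))\<^sup>2)"
      unfolding set_integral_time_interval_full f_int(2)
      by (rule Bochner_Integration.integral_diff[OF f_int(1) Edu_int])
    finally show ?thesis using L_energy[of T] \<open>T > 0\<close> by simp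
  qed
  have claim3: "L2_norm P (\<lambda>\<omega>. E (u t2 \<omega>)) \<le> L2_norm P (\<lambda>\<omega>. E (u t1 \<omega>))
      \<and> (symmetric_op P L \<longrightarrow> energy_norm P L (u t2) \<le> energy_norm P L (u t1))"
    if f0: "AE t in ?M. AE \<omega> in P. f t \<omega> = 0" and t: "0 \<le> t1" "t1 \<le> t2" "t2 \<le> T" for t1 t2
  proof -
    \<comment> \<open>Without forcing the rates \<open>kH\<close> and \<open>kL\<close> are
      non-positive almost everywhere, so the squared norms decrease along with their
      primitives.\<close>
    have "AE t in ?M. kH t \<le> 0"
      using kH_le f0
    proof eventually_elim
      case (elim t)
      have "0 \<le> C_L * (L2_norm P (u t))\<^sup>2" using \<open>C_L > 0\<close> by simp
      then show ?case using elim by (simp add: L2_norm_zero)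
    qed
    then have "(L2_norm P (\<lambda>\<omega>. E (u t2 \<omega>)))\<^sup>2 \<le> (L2_norm P (\<lambda>\<omega>. E (u t1 \<omega>)))\<^sup>2"
      using primitive_antimono[OF kH_int _ t(2)] H_energy[of t1] H_energy[of t2] t by simp
    then have 1: "L2_norm P (\<lambda>\<omega>. E (u t2 \<omega>)) \<le> L2_norm P (\<lambda>\<omega>. E (u t1 \<omega>))"
      by (rule power2_le_imp_le) (simp add: L2_norm_def)
    have 2: "energy_norm P L (u t2) \<le> energy_norm P L (u t1)" if sym: "symmetric_op P L"
    proof -
      have "AE t in ?M. kL t \<le> 0"
        using kL_le[OF sym] f0
      proof eventually_elim
        case (elim t)
        from elim(1) show ?case by (rule order_trans) (simp add: L2_norm_zero elim(2))
      qed
      then have "(energy_norm P L (u t2))\<^sup>2 \<le> (energy_norm P L (u t1))\<^sup>2"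
        using primitive_antimono[OF kL_int _ t(2)] L_energy[of t1] L_energy[of t2] t by simp
      then show ?thesis
        by (rule power2_le_imp_le)
          (simp add: energy_norm_def energy_form_coercive[where P = P and L = L and C_L = C_L, OF assms(7,6)])
    qed
    show ?thesis using 1 2 by blast
  qed
  show ?thesis using claim1 claim2 claim3 by blast
qed

end
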